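(* Let $A$ be a punctual injection structure which is relatively $\Delta^0_2$-categorical but not relatively $\Delta^0_1$-categorical. Then $\mathrm{PRCatSpec}(A)=\mathrm{Cone}(\Delta^0_2)$.
   Context: A punctual structure is a structure with domain $\omega$ whose operations and relations are uniformly primitive recursive. An injection structure is a structure $(D,f)$ in the language of one unary function symbol, with $f:D\to D$ injective. A computable structure $A$ is relatively $\Delta^0_\alpha$-categorical if for every structure $B\cong A$ with domain $\omega$ (not necessarily computable) there is an isomorphism from $A$ to $B$ which is $\Delta^0_\alpha$ relative to the atomic diagram of $B$. For total functions $f,g:\omega\to\omega$, write $f\leq_{PR} g$ if there is a primitive recursive scheme $\Psi$ (a primitive recursive definition which may additionally use the oracle function as a basic function) with $\Psi^{g}=f$. Write $f\equiv_{PR}g$ if $f\leq_{PR}g$ and $g\leq_{PR}f$. The $\equiv_{PR}$-classes are the PR-degrees, ordered by $\leq_{PR}$. For a punctual structure $A$, $\mathrm{PRCatSpec}(A)$ is the set of all PR-degrees $\mathbf d$ such that for every punctual structure $B\cong A$ there is an isomorphism $f:A\to B$ with $f\leq_{PR}\mathbf d$ and $f^{-1}\leq_{PR}\mathbf d$. For a computable ordinal $\alpha>0$, $\mathrm{Cone}(\Delta^0_\alpha)$ is the set of all PR-degrees $\mathbf d$ such that $f\leq_{PR}\mathbf d$ for every total $\Delta^0_\alpha$ function $f:\omega\to\omega$. *)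

theory Defs
  imports "HOL-Library.Nat_Bijection"
begin

datatype scheme =
    Zero
  | Succ
  | Proj nat
  | Oracle
  | Comp scheme "scheme list"
  | PrimRec scheme scheme
  | Mu scheme

text \<open>Zero stands for the constant zero function of every arity, and projections are
  numbered from 0.\<close>

fun has_arity :: "nat \<Rightarrow> scheme \<Rightarrow> bool" where
  "has_arity n Zero \<longleftrightarrow> True"
| "has_arity n Succ \<longleftrightarrow> n = 1"
| "has_arity n (Proj i) \<longleftrightarrow> i < n"
| "has_arity n Oracle \<longleftrightarrow> n = 1"
| "has_arity n (Comp h gs) \<longleftrightarrow> has_arity (length gs) h \<and> (\<forall>g \<in> set gs. has_arity n g)"
| "has_arity n (PrimRec g h) \<longleftrightarrow>
     (\<exists>m. n = Suc m \<and> has_arity m g \<and> has_arity (Suc (Suc m)) h)"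
| "has_arity n (Mu e) \<longleftrightarrow> has_arity (Suc n) e"

fun mu_free :: "scheme \<Rightarrow> bool" where
  "mu_free (Comp h gs) \<longleftrightarrow> mu_free h \<and> (\<forall>g \<in> set gs. mu_free g)"
| "mu_free (PrimRec g h) \<longleftrightarrow> mu_free g \<and> mu_free h"
| "mu_free (Mu e) \<longleftrightarrow> False"
| "mu_free _ \<longleftrightarrow> True"

fun oracle_free :: "scheme \<Rightarrow> bool" where
  "oracle_free Oracle \<longleftrightarrow> False"
| "oracle_free (Comp h gs) \<longleftrightarrow> oracle_free h \<and> (\<forall>g \<in> set gs. oracle_free g)"
| "oracle_free (PrimRec g h) \<longleftrightarrow> oracle_free g \<and> oracle_free h"
| "oracle_free (Mu e) \<longleftrightarrow> oracle_free e"
| "oracle_free _ \<longleftrightarrow> True"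

text \<open>\<open>evals X e xs y\<close>: with oracle \<open>X\<close>, the computation of \<open>e\<close> on the
  argument tuple \<open>xs\<close> converges with value \<open>y\<close>. Unbounded search is partial: it requires
  convergence at all smaller candidates.\<close>

inductive evals :: "(nat \<Rightarrow> nat) \<Rightarrow> scheme \<Rightarrow> nat list \<Rightarrow> nat \<Rightarrow> bool"
  for X :: "nat \<Rightarrow> nat" where
  evals_Zero: "evals X Zero xs 0"
| evals_Succ: "evals X Succ [x] (Suc x)"
| evals_Proj: "i < length xs \<Longrightarrow> evals X (Proj i) xs (xs ! i)"
| evals_Oracle: "evals X Oracle [x] (X x)"
| evals_Comp: "list_all2 (\<lambda>g y. evals X g xs y) gs ys \<Longrightarrow> evals X h ys z
    \<Longrightarrow> evals X (Comp h gs) xs z"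
| evals_PrimRec_0: "evals X g xs y \<Longrightarrow> evals X (PrimRec g h) (0 # xs) y"
| evals_PrimRec_Suc: "evals X (PrimRec g h) (n # xs) y \<Longrightarrow> evals X h (n # y # xs) z
    \<Longrightarrow> evals X (PrimRec g h) (Suc n # xs) z"
| evals_Mu: "evals X e (y # xs) 0 \<Longrightarrow> (\<And>z. z < y \<Longrightarrow> \<exists>v. evals X e (z # xs) (Suc v))
    \<Longrightarrow> evals X (Mu e) xs y"

definition primitive_recursive :: "(nat \<Rightarrow> nat) \<Rightarrow> bool" where
  "primitive_recursive f \<longleftrightarrow>
     (\<exists>e. has_arity 1 e \<and> mu_free e \<and> oracle_free e \<and> (\<forall>X x. evals X e [x] (f x)))"

definition pr_le :: "(nat \<Rightarrow> nat) \<Rightarrow> (nat \<Rightarrow> nat) \<Rightarrow> bool" (infix "\<le>PR" 50) where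
  "f \<le>PR g \<longleftrightarrow> (\<exists>e. has_arity 1 e \<and> mu_free e \<and> (\<forall>x. evals g e [x] (f x)))"

definition pr_equiv :: "(nat \<Rightarrow> nat) \<Rightarrow> (nat \<Rightarrow> nat) \<Rightarrow> bool" (infix "\<equiv>PR" 50) where
  "f \<equiv>PR g \<longleftrightarrow> f \<le>PR g \<and> g \<le>PR f"

definition pr_degrees :: "(nat \<Rightarrow> nat) set set" where
  "pr_degrees = UNIV // {(f, g). f \<equiv>PR g}"

definition pr_le_degree :: "(nat \<Rightarrow> nat) \<Rightarrow> (nat \<Rightarrow> nat) set \<Rightarrow> bool" where
  "pr_le_degree f d \<longleftrightarrow> (\<exists>g \<in> d. f \<le>PR g)"

text \<open>A \<open>k\<close>-ary relation is a predicate on lists, of which only the values at lists of length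
  \<open>k\<close> matter.\<close>

definition computable_rel :: "(nat \<Rightarrow> nat) \<Rightarrow> nat \<Rightarrow> (nat list \<Rightarrow> bool) \<Rightarrow> bool" where
  "computable_rel X k R \<longleftrightarrow>
     (\<exists>e. has_arity k e \<and> (\<forall>xs. length xs = k \<longrightarrow> evals X e xs (of_bool (R xs))))"

fun Sigma_rel Pi_rel :: "nat \<Rightarrow> (nat \<Rightarrow> nat) \<Rightarrow> nat \<Rightarrow> (nat list \<Rightarrow> bool) \<Rightarrow> bool" where
  "Sigma_rel 0 X k R \<longleftrightarrow> computable_rel X k R"
| "Sigma_rel (Suc n) X k R \<longleftrightarrow>
     (\<exists>Q. Pi_rel n X (Suc k) Q \<and> (\<forall>xs. length xs = k \<longrightarrow> (R xs \<longleftrightarrow> (\<exists>y. Q (y # xs)))))"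
| "Pi_rel 0 X k R \<longleftrightarrow> computable_rel X k R"
| "Pi_rel (Suc n) X k R \<longleftrightarrow>
     (\<exists>Q. Sigma_rel n X (Suc k) Q \<and> (\<forall>xs. length xs = k \<longrightarrow> (R xs \<longleftrightarrow> (\<forall>y. Q (y # xs)))))"

definition Delta_rel :: "nat \<Rightarrow> (nat \<Rightarrow> nat) \<Rightarrow> nat \<Rightarrow> (nat list \<Rightarrow> bool) \<Rightarrow> bool" where
  "Delta_rel n X k R \<longleftrightarrow> Sigma_rel n X k R \<and> Pi_rel n X k R"

text \<open>A total function is \<open>\<Delta>\<^sup>0\<^sub>n\<close> relative to \<open>X\<close> when its graph is; the lightface classes are
  those relative to the empty set, that is, to the constant zero function.\<close>

definition Delta_fun_in :: "nat \<Rightarrow> (nat \<Rightarrow> nat) \<Rightarrow> (nat \<Rightarrow> nat) \<Rightarrow> bool" where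
  "Delta_fun_in n X f \<longleftrightarrow> Delta_rel n X 2 (\<lambda>xs. f (xs ! 0) = xs ! 1)"

definition Delta_fun :: "nat \<Rightarrow> (nat \<Rightarrow> nat) \<Rightarrow> bool" where
  "Delta_fun n f \<longleftrightarrow> Delta_fun_in n (\<lambda>_. 0) f"

text \<open>A structure \<open>(\<omega>, f)\<close> with one unary operation is represented by \<open>f\<close>. As the language
  has a single operation symbol, uniform primitive recursiveness is that of \<open>f\<close>.\<close>

type_synonym structure_1 = "nat \<Rightarrow> nat"

definition punctual :: "structure_1 \<Rightarrow> bool" where
  "punctual A \<longleftrightarrow> primitive_recursive A"

definition injection_structure :: "structure_1 \<Rightarrow> bool" where
  "injection_structure A \<longleftrightarrow> inj A"

definition isomorphism :: "structure_1 \<Rightarrow> structure_1 \<Rightarrow> (nat \<Rightarrow> nat) \<Rightarrow> bool" where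
  "isomorphism A B h \<longleftrightarrow> bij h \<and> (\<forall>x. h (A x) = B (h x))"

definition isomorphic_1 :: "structure_1 \<Rightarrow> structure_1 \<Rightarrow> bool" where
  "isomorphic_1 A B \<longleftrightarrow> (\<exists>h. isomorphism A B h)"

text \<open>With a constant for each element, the closed terms are \<open>f\<^sup>k(a)\<close>. The literals
  \<open>f\<^sup>k(a) = f\<^sup>l(b)\<close> and \<open>f\<^sup>k(a) \<noteq> f\<^sup>l(b)\<close> are coded with first component 0 and 1,
  respectively.\<close>

definition literal_code :: "nat \<Rightarrow> nat \<Rightarrow> nat \<Rightarrow> nat \<Rightarrow> nat \<Rightarrow> nat" where
  "literal_code s k a l b =
     prod_encode (s, prod_encode (prod_encode (k, a), prod_encode (l, b)))"

definition atomic_diagram :: "structure_1 \<Rightarrow> nat set" where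
  "atomic_diagram B =
     {literal_code 0 k a l b | k a l b. (B ^^ k) a = (B ^^ l) b} \<union>
     {literal_code 1 k a l b | k a l b. (B ^^ k) a \<noteq> (B ^^ l) b}"

definition char_fun :: "nat set \<Rightarrow> nat \<Rightarrow> nat" where
  "char_fun S x = of_bool (x \<in> S)"

definition relatively_Delta_categorical :: "nat \<Rightarrow> structure_1 \<Rightarrow> bool" where
  "relatively_Delta_categorical n A \<longleftrightarrow>
     (\<forall>B. isomorphic_1 B A \<longrightarrow>
        (\<exists>h. isomorphism A B h \<and> Delta_fun_in n (char_fun (atomic_diagram B)) h))"

definition PRCatSpec :: "structure_1 \<Rightarrow> (nat \<Rightarrow> nat) set set" where
  "PRCatSpec A =
     {d \<in> pr_degrees. \<forall>B. punctual B \<and> isomorphic_1 B A \<longrightarrow>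
        (\<exists>h. isomorphism A B h \<and> pr_le_degree h d \<and> pr_le_degree (inv h) d)}"

definition Cone_Delta :: "nat \<Rightarrow> (nat \<Rightarrow> nat) set set" where
  "Cone_Delta n = {d \<in> pr_degrees. \<forall>f. Delta_fun n f \<longrightarrow> pr_le_degree f d}"

end

theory Submission
  imports Defs "HOL-Library.Infinite_Set"
begin


text \<open>If only finitely many orbits of \<open>A\<close> were infinite, pairing representatives of these and the
  \<open>m\<close>-th cycles of each length on both sides would give an isomorphism computable from the atomic
  diagram of the copy. So \<open>A\<close> has infinitely many infinite orbits of one type (\<open>\<omega>\<close>-chains or
  \<open>\<int>\<close>-chains). Let \<open>f\<close> be \<open>\<Delta>\<^sup>0\<^sub>2\<close>. A primitive recursive approximation of \<open>f\<close> yields a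
  primitive recursive \<open>a\<close> with finite fibres, \<open>a s\<close> being an argument whose approximation changes at
  stage \<open>s\<close>; any bound on the stages \<open>s\<close> with \<open>a s \<le> n\<close> gives \<open>f n\<close>. Build a punctual copy of \<open>A\<close>
  in which each row is an orbit of this type, and another one in which row \<open>s + 1\<close> is merged with the
  next row as soon as some \<open>r > s\<close> with \<open>a r \<le> a s\<close> appears. An isomorphism from the first to the
  second sends the first \<open>n + 3\<close> rows to different orbits, hence to numbers not all below the
  \<open>n\<close>-th true stage of \<open>a\<close>. It thus computes \<open>f\<close> primitive recursively. Conversely, the atomic
  diagram of a punctual copy is computable, so relative \<open>\<Delta>\<^sup>0\<^sub>2\<close>-categoricity gives
  \<open>\<Delta>\<^sup>0\<^sub>2\<close> isomorphisms.\<close>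

section \<open>Classes of functions closed under composition and primitive recursion\<close>

text \<open>The obstacle is that the copies must be punctual: the domain is all of omega and every
  value is found without unbounded search. So nothing can wait until it is known which elements of
  \<open>A\<close> are periodic or which rows survive. A periodic element is therefore represented
  together with its period: the test that \<open>p\<close> is the exact period of \<open>x\<close>
  is bounded, and each periodic \<open>x\<close> occurs in exactly one pair. A row that has to die
  cannot be withdrawn; joining it to its successor leaves infinitely many orbits and creates no new
  orbit type. Numbers that code nothing must be placed as well, and row 0, which never dies, absorbs
  them. Whether the orbits of the other type are finite or infinite in number is one fixed fact
  about \<open>A\<close>, so it may be built into the construction. On the side of the degree, an
  isomorphism may be evaluated but not searched through, which is why only an upper bound on stages
  is extracted from it.\<close>

locale scheme_class =
  fixes ok :: "scheme \<Rightarrow> bool" and Or :: "(nat \<Rightarrow> nat) set"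
  assumes ok_Zero: "ok Zero" and ok_Succ: "ok Succ" and ok_Proj: "ok (Proj i)"
    and ok_Comp: "ok h \<Longrightarrow> (\<And>g. g \<in> set gs \<Longrightarrow> ok g) \<Longrightarrow> ok (Comp h gs)"
    and ok_PrimRec: "ok g \<Longrightarrow> ok h \<Longrightarrow> ok (PrimRec g h)"
begin

text \<open>\<open>Or\<close> is the set of oracles under which one and the same scheme has to
  compute \<open>F\<close>. Three instances are used: schemes without search and oracle for all
  oracles at once, schemes without search for one oracle, and all schemes for one oracle.\<close>

definition definable :: "nat \<Rightarrow> (nat list \<Rightarrow> nat) \<Rightarrow> bool" where
  "definable k F \<longleftrightarrow> (\<exists>e. has_arity k e \<and> ok e \<and>
     (\<forall>X\<in>Or. \<forall>xs. length xs = k \<longrightarrow> evals X e xs (F xs)))"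

abbreviation decidable :: "nat \<Rightarrow> (nat list \<Rightarrow> bool) \<Rightarrow> bool" where
  "decidable k R \<equiv> definable k (\<lambda>xs. of_bool (R xs))"

lemma definable_cong:
  "(\<And>xs. length xs = k \<Longrightarrow> F xs = G xs) \<Longrightarrow> definable k F \<Longrightarrow> definable k G"
  unfolding definable_def by metis

lemma definable_zero: "definable k (\<lambda>_. 0)"
  unfolding definable_def by (intro exI[of _ Zero]) (auto simp: ok_Zero intro: evals_Zero)

lemma definable_nth: "i < k \<Longrightarrow> definable k (\<lambda>xs. xs ! i)"
  unfolding definable_def using ok_Proj evals_Proj by (intro exI[of _ "Proj i"]) auto

lemma definable_compose:
  assumes H: "definable (length Gs) H" and G: "\<And>G. G \<in> set Gs \<Longrightarrow> definable k G"
  shows "definable k (\<lambda>xs. H (map (\<lambda>G. G xs) Gs))"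
proof -
  from H obtain h where h: "has_arity (length Gs) h" "ok h"
    "\<And>X xs. X \<in> Or \<Longrightarrow> length xs = length Gs \<Longrightarrow> evals X h xs (H xs)"
    unfolding definable_def by metis
  define c where "c G = (SOME e. has_arity k e \<and> ok e \<and>
     (\<forall>X\<in>Or. \<forall>xs. length xs = k \<longrightarrow> evals X e xs (G xs)))" for G
  have c: "has_arity k (c G) \<and> ok (c G) \<and>
     (\<forall>X\<in>Or. \<forall>xs. length xs = k \<longrightarrow> evals X (c G) xs (G xs))" if "G \<in> set Gs" for G
    using G[OF that] unfolding definable_def c_def by (rule someI_ex)
  have "evals X (Comp h (map c Gs)) xs (H (map (\<lambda>G. G xs) Gs))" if "X \<in> Or" "length xs = k" for X xs
    by (rule evals_Comp[where ys = "map (\<lambda>G. G xs) Gs"])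
      (use that c h(3) in \<open>auto simp: list_all2_conv_all_nth\<close>)
  then show ?thesis unfolding definable_def
    by (intro exI[of _ "Comp h (map c Gs)"]) (use h c in \<open>auto intro!: ok_Comp\<close>)
qed

lemma definable_primrec:
  assumes G: "definable m G" and H: "definable (Suc (Suc m)) H"
  shows "definable (Suc m) (\<lambda>xs. rec_nat (G (tl xs)) (\<lambda>n y. H (n # y # tl xs)) (hd xs))"
proof -
  from G obtain g where g: "has_arity m g" "ok g"
    "\<And>X xs. X \<in> Or \<Longrightarrow> length xs = m \<Longrightarrow> evals X g xs (G xs)"
    unfolding definable_def by metis
  from H obtain h where h: "has_arity (Suc (Suc m)) h" "ok h"
    "\<And>X xs. X \<in> Or \<Longrightarrow> length xs = Suc (Suc m) \<Longrightarrow> evals X h xs (H xs)"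
    unfolding definable_def by metis
  have *: "evals X (PrimRec g h) (n # xs) (rec_nat (G xs) (\<lambda>n y. H (n # y # xs)) n)"
    if "X \<in> Or" "length xs = m" for X xs n
    by (induction n) (use that g h in \<open>auto intro: evals.intros\<close>)
  show ?thesis unfolding definable_def
    by (intro exI[of _ "PrimRec g h"])
      (use g h * in \<open>auto intro!: ok_PrimRec simp: length_Suc_conv\<close>)
qed

lemma definable_weaken: "definable k F \<Longrightarrow> definable (Suc k) (\<lambda>ys. F (tl ys))"
proof -
  assume F: "definable k F"
  have "definable (Suc k) (\<lambda>ys. F (map (\<lambda>G. G ys) (map (\<lambda>i ys. ys ! Suc i) [0..<k])))"
    by (rule definable_compose) (use F definable_nth in auto)
  then show ?thesis
    by (rule definable_cong[rotated]) (auto intro!: arg_cong[of _ _ F] nth_equalityI simp: nth_tl)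
qed

lemma definable_rec:
  assumes N: "definable k N" and G: "definable k G"
    and H: "definable (Suc (Suc k)) (\<lambda>ys. H (hd ys) (hd (tl ys)) (tl (tl ys)))"
  shows "definable k (\<lambda>xs. rec_nat (G xs) (\<lambda>n y. H n y xs) (N xs))"
proof -
  note 1 = definable_primrec[OF G H, simplified]
  have "definable k (\<lambda>xs. (\<lambda>xs. rec_nat (G (tl xs)) (\<lambda>n y. H n y (tl xs)) (hd xs))
      (map (\<lambda>G. G xs) (N # map (\<lambda>i xs. xs ! i) [0..<k])))"
    by (rule definable_compose) (use 1 N definable_nth in auto)
  then show ?thesis
  proof (rule definable_cong[rotated])
    fix xs :: "nat list" assume "length xs = k"
    then have "map (\<lambda>G. G xs) (map (\<lambda>i xs. xs ! i) [0..<k]) = xs"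
      by (auto intro!: nth_equalityI)
    then show "rec_nat (G (tl (map (\<lambda>G. G xs) (N # map (\<lambda>i xs. xs ! i) [0..<k]))))
       (\<lambda>n y. H n y (tl (map (\<lambda>G. G xs) (N # map (\<lambda>i xs. xs ! i) [0..<k]))))
       (hd (map (\<lambda>G. G xs) (N # map (\<lambda>i xs. xs ! i) [0..<k]))) =
      rec_nat (G xs) (\<lambda>n y. H n y xs) (N xs)"
      by simp
  qed
qed

lemma definable_hd: "0 < k \<Longrightarrow> definable k hd"
  by (rule definable_cong[OF _ definable_nth[of 0 k]]) (auto simp: hd_conv_nth)

lemma definable_app1:
  assumes "definable 1 (\<lambda>xs. f (hd xs))" "definable k F"
  shows "definable k (\<lambda>xs. f (F xs))"
  using definable_compose[of "[F]" "\<lambda>xs. f (hd xs)" k] assms by simp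

lemma definable_app2:
  assumes "definable 2 (\<lambda>xs. f (hd xs) (hd (tl xs)))" "definable k F" "definable k G"
  shows "definable k (\<lambda>xs. f (F xs) (G xs))"
  using definable_compose[of "[F, G]" "\<lambda>xs. f (hd xs) (hd (tl xs))" k] assms
  by (auto simp: numeral_2_eq_2)

lemma definable_app3:
  assumes "definable 3 (\<lambda>xs. f (hd xs) (hd (tl xs)) (hd (tl (tl xs))))"
    "definable k F" "definable k G" "definable k H"
  shows "definable k (\<lambda>xs. f (F xs) (G xs) (H xs))"
  using definable_compose[of "[F, G, H]" "\<lambda>xs. f (hd xs) (hd (tl xs)) (hd (tl (tl xs)))" k] assms
  by (auto simp: numeral_3_eq_3)

text \<open>Quantifiers, recursion and search bind a new variable at the head of the list and reach
  the outer variables through \<open>tl\<close>. These rules and the next ones let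
  \<open>intro\<close> deal with such nested variables.\<close>

lemma definable_hd_tl:
  "Suc 0 < k \<Longrightarrow> definable k (\<lambda>xs. hd (tl xs))"
  "Suc (Suc 0) < k \<Longrightarrow> definable k (\<lambda>xs. hd (tl (tl xs)))"
  "Suc (Suc (Suc 0)) < k \<Longrightarrow> definable k (\<lambda>xs. hd (tl (tl (tl xs))))"
  "Suc (Suc (Suc (Suc 0))) < k \<Longrightarrow> definable k (\<lambda>xs. hd (tl (tl (tl (tl xs)))))"
  "Suc (Suc (Suc (Suc (Suc 0)))) < k \<Longrightarrow> definable k (\<lambda>xs. hd (tl (tl (tl (tl (tl xs))))))"
  "Suc (Suc (Suc (Suc (Suc (Suc 0))))) < k \<Longrightarrow> definable k (\<lambda>xs. hd (tl (tl (tl (tl (tl (tl xs)))))))"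
  "Suc (Suc (Suc (Suc (Suc (Suc (Suc 0)))))) < k \<Longrightarrow> definable k (\<lambda>xs. hd (tl (tl (tl (tl (tl (tl (tl xs))))))))"
  by (cases k; auto intro!: definable_weaken definable_hd dest!: less_imp_Suc_add)+

lemma definable_nth_tl:
  "Suc i < k \<Longrightarrow> definable k (\<lambda>xs. tl xs ! i)"
  "Suc (Suc i) < k \<Longrightarrow> definable k (\<lambda>xs. tl (tl xs) ! i)"
  "Suc (Suc (Suc i)) < k \<Longrightarrow> definable k (\<lambda>xs. tl (tl (tl xs)) ! i)"
  "Suc (Suc (Suc (Suc i))) < k \<Longrightarrow> definable k (\<lambda>xs. tl (tl (tl (tl xs))) ! i)"
  "Suc (Suc (Suc (Suc (Suc i)))) < k \<Longrightarrow> definable k (\<lambda>xs. tl (tl (tl (tl (tl xs)))) ! i)"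
  by (cases k; auto intro!: definable_weaken definable_nth dest!: less_imp_Suc_add)+

lemma definable_Suc: "definable k F \<Longrightarrow> definable k (\<lambda>xs. Suc (F xs))"
  by (rule definable_app1)
    (auto simp: definable_def length_Suc_conv intro!: exI[of _ Succ] ok_Succ evals_Succ)

lemma definable_const: "definable k (\<lambda>_. c)"
  by (induction c) (auto intro: definable_zero definable_Suc)

lemmas definable_base = definable_const definable_hd definable_hd_tl definable_nth definable_nth_tl
  definable_Suc

lemma definable_pred: "definable k F \<Longrightarrow> definable k (\<lambda>xs. F xs - 1)"
proof (rule definable_cong)
  show "definable k F \<Longrightarrow> definable k (\<lambda>xs. rec_nat 0 (\<lambda>n _. n) (F xs))"
    by (intro definable_rec definable_base) auto
  show "rec_nat 0 (\<lambda>n _. n) (F xs) = F xs - 1" for xs by (cases "F xs") auto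
qed

lemma definable_add:
  "definable k F \<Longrightarrow> definable k G \<Longrightarrow> definable k (\<lambda>xs. F xs + G xs)"
proof (rule definable_cong)
  show "definable k F \<Longrightarrow> definable k G \<Longrightarrow> definable k (\<lambda>xs. rec_nat (F xs) (\<lambda>_ y. Suc y) (G xs))"
    by (intro definable_rec definable_base) auto
  have "rec_nat a (\<lambda>_ y. Suc y) b = a + b" for a b :: nat by (induction b) auto
  then show "rec_nat (F xs) (\<lambda>_ y. Suc y) (G xs) = F xs + G xs" for xs .
qed

lemma definable_diff:
  "definable k F \<Longrightarrow> definable k G \<Longrightarrow> definable k (\<lambda>xs. F xs - G xs)"
proof (rule definable_cong)
  show "definable k F \<Longrightarrow> definable k G \<Longrightarrow> definable k (\<lambda>xs. rec_nat (F xs) (\<lambda>_ y. y - 1) (G xs))"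
    by (intro definable_rec definable_pred definable_base) auto
  have "rec_nat a (\<lambda>_ y. y - 1) b = a - b" for a b :: nat by (induction b) auto
  then show "rec_nat (F xs) (\<lambda>_ y. y - 1) (G xs) = F xs - G xs" for xs .
qed

lemma decidable_not: "decidable k P \<Longrightarrow> decidable k (\<lambda>xs. \<not> P xs)"
  by (rule definable_cong[OF _ definable_diff[OF definable_const[of k 1]]]) auto

lemma decidable_le:
  "definable k F \<Longrightarrow> definable k G \<Longrightarrow> decidable k (\<lambda>xs. F xs \<le> G xs)"
  by (rule definable_cong[OF _ definable_diff[OF definable_const[of k 1] definable_diff[of k F G]]]) auto

lemma definable_if:
  assumes "decidable k P" "definable k F" "definable k G"
  shows "definable k (\<lambda>xs. if P xs then F xs else G xs)"
proof (rule definable_cong)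
  show "definable k (\<lambda>xs. rec_nat (G xs) (\<lambda>_ _. F xs) (of_bool (P xs)))"
    by (intro definable_rec definable_weaken assms)
qed auto

lemma decidable_conj: "decidable k P \<Longrightarrow> decidable k Q \<Longrightarrow> decidable k (\<lambda>xs. P xs \<and> Q xs)"
  by (rule definable_cong[OF _ definable_if[of k P "\<lambda>xs. of_bool (Q xs)", OF _ _ definable_const[of k 0]]])
    auto

lemma decidable_disj: "decidable k P \<Longrightarrow> decidable k Q \<Longrightarrow> decidable k (\<lambda>xs. P xs \<or> Q xs)"
  by (rule definable_cong[OF _ definable_if[of k P "\<lambda>_. 1" "\<lambda>xs. of_bool (Q xs)", OF _ definable_const]]) auto

lemma decidable_imp: "decidable k P \<Longrightarrow> decidable k Q \<Longrightarrow> decidable k (\<lambda>xs. P xs \<longrightarrow> Q xs)"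
  by (rule definable_cong[OF _ definable_if[of k P "\<lambda>xs. of_bool (Q xs)", OF _ _ definable_const[of k 1]]]) auto

lemma decidable_less:
  "definable k F \<Longrightarrow> definable k G \<Longrightarrow> decidable k (\<lambda>xs. F xs < G xs)"
  by (rule definable_cong[OF _ decidable_le[of k "\<lambda>xs. Suc (F xs)" G]]) (auto intro: definable_Suc)

lemma decidable_eq:
  "definable k F \<Longrightarrow> definable k G \<Longrightarrow> decidable k (\<lambda>xs. F xs = G xs)"
  by (rule definable_cong[OF _ decidable_conj[of k "\<lambda>xs. F xs \<le> G xs" "\<lambda>xs. G xs \<le> F xs"]])
    (auto intro: decidable_le)

section \<open>Bounded quantifiers, counting and bounded search\<close>

lemma decidable_ball:
  assumes "definable k N" "decidable (Suc k) (\<lambda>ys. Q (hd ys) (tl ys))"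
  shows "decidable k (\<lambda>xs. \<forall>i<N xs. Q i xs)"
proof (rule definable_cong)
  \<comment> \<open>The recursion puts its accumulator between the bound variable and the
    parameters, so the matrix is needed in a version that skips this position.\<close>
  have "decidable (Suc (Suc k)) (\<lambda>ys. Q (hd ys) (tl (tl ys)))"
  proof -
    have "definable (Suc (Suc k)) (\<lambda>xs. (\<lambda>ys. of_bool (Q (hd ys) (tl ys)))
      (map (\<lambda>G. G xs) (hd # map (\<lambda>i xs. xs ! Suc (Suc i)) [0..<k])))"
      by (rule definable_compose) (use assms(2) in \<open>auto intro: definable_base\<close>)
    then show ?thesis
    proof (rule definable_cong[rotated])
      fix xs :: "nat list" assume l: "length xs = Suc (Suc k)"
      then have "map (\<lambda>G. G xs) (map (\<lambda>i xs. xs ! Suc (Suc i)) [0..<k]) = tl (tl xs)"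
        by (auto intro!: nth_equalityI simp: nth_tl)
      then show "of_bool (Q (hd (map (\<lambda>G. G xs) (hd # map (\<lambda>i xs. xs ! Suc (Suc i)) [0..<k])))
          (tl (map (\<lambda>G. G xs) (hd # map (\<lambda>i xs. xs ! Suc (Suc i)) [0..<k]))))
         = (of_bool (Q (hd xs) (tl (tl xs))) :: nat)" by simp
    qed
  qed
  then show "definable k (\<lambda>xs. rec_nat 1 (\<lambda>i y. if Q i xs then y else 0) (N xs))"
    by (intro definable_rec definable_if definable_base assms) auto
  have "rec_nat 1 (\<lambda>i y. if Q i xs then y else 0) n = of_bool (\<forall>i<n. Q i xs)" for n xs
    by (induction n) (auto simp: less_Suc_eq)
  then show "rec_nat 1 (\<lambda>i y. if Q i xs then y else 0) (N xs) = of_bool (\<forall>i<N xs. Q i xs)" for xs .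
qed

lemma decidable_bex:
  assumes "definable k N" "decidable (Suc k) (\<lambda>ys. Q (hd ys) (tl ys))"
  shows "decidable k (\<lambda>xs. \<exists>i<N xs. Q i xs)"
  using decidable_not[OF decidable_ball[OF assms(1) decidable_not[OF assms(2)]]] by simp

lemma decidable_ball_le:
  assumes "definable k N" "decidable (Suc k) (\<lambda>ys. Q (hd ys) (tl ys))"
  shows "decidable k (\<lambda>xs. \<forall>i\<le>N xs. Q i xs)"
  using decidable_ball[OF definable_Suc[OF assms(1)] assms(2)] by (simp add: less_Suc_eq_le)

lemma decidable_bex_le:
  assumes "definable k N" "decidable (Suc k) (\<lambda>ys. Q (hd ys) (tl ys))"
  shows "decidable k (\<lambda>xs. \<exists>i\<le>N xs. Q i xs)"
  using decidable_bex[OF definable_Suc[OF assms(1)] assms(2)] by (simp add: less_Suc_eq_le)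

lemma definable_count:
  assumes "definable k N" "decidable (Suc k) (\<lambda>ys. Q (hd ys) (tl ys))"
    "decidable (Suc (Suc k)) (\<lambda>ys. Q (hd ys) (tl (tl ys)))"
  shows "definable k (\<lambda>xs. card {i. i < N xs \<and> Q i xs})"
proof (rule definable_cong)
  show "definable k (\<lambda>xs. rec_nat 0 (\<lambda>i y. if Q i xs then Suc y else y) (N xs))"
    by (intro definable_rec definable_if definable_base assms) auto
  have "rec_nat 0 (\<lambda>i y. if Q i xs then Suc y else y) n = card {i. i < n \<and> Q i xs}" for n xs
  proof (induction n)
    case (Suc n)
    have "{i. i < Suc n \<and> Q i xs} = (if Q n xs then insert n else id) {i. i < n \<and> Q i xs}"
      by (auto simp: less_Suc_eq)
    then show ?case using Suc by simp
  qed simp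
  then show "rec_nat 0 (\<lambda>i y. if Q i xs then Suc y else y) (N xs) = card {i. i < N xs \<and> Q i xs}" for xs .
qed

lemma definable_Least:
  assumes "definable k N" "decidable (Suc k) (\<lambda>ys. Q (hd ys) (tl ys))"
    and ex: "\<And>xs. length xs = k \<Longrightarrow> \<exists>i\<le>N xs. Q i xs"
  shows "definable k (\<lambda>xs. LEAST i. Q i xs)"
proof (rule definable_cong)
  \<comment> \<open>The minimum is the number of \<open>i\<close> up to which no solution has
    occurred. A minimum equal to \<open>N xs\<close> is counted correctly, since then every
    \<open>i < N xs\<close> counts.\<close>
  show "definable k (\<lambda>xs. card {i. i < N xs \<and> (\<forall>j\<le>i. \<not> Q j xs)})"
  proof (intro definable_count assms decidable_ball_le decidable_not definable_base)
    \<comment> \<open>One extra position comes from the outer variable \<open>i\<close> of the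
      count, a second one from the accumulator of its recursion.\<close>
    have *: "definable (Suc (m + k)) (\<lambda>ys. of_bool (Q (hd ys) ((tl ^^ Suc m) ys)))" for m
    proof -
      have "definable (Suc (m + k)) (\<lambda>xs. (\<lambda>ys. of_bool (Q (hd ys) (tl ys)))
        (map (\<lambda>G. G xs) (hd # map (\<lambda>i xs. xs ! Suc (m + i)) [0..<k])))"
        by (rule definable_compose) (use assms(2) in \<open>auto intro: definable_base\<close>)
      then show ?thesis
      proof (rule definable_cong[rotated])
        fix xs :: "nat list" assume l: "length xs = Suc (m + k)"
        have d: "(tl ^^ m) xs = drop m xs" for m and xs :: "nat list"
          by (induction m arbitrary: xs) (auto simp: drop_Suc tl_drop)
        have "map (\<lambda>G. G xs) (map (\<lambda>i xs. xs ! Suc (m + i)) [0..<k]) = (tl ^^ Suc m) xs"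
          unfolding d using l by (auto intro!: nth_equalityI)
        then show "of_bool (Q (hd (map (\<lambda>G. G xs) (hd # map (\<lambda>i xs. xs ! Suc (m + i)) [0..<k])))
            (tl (map (\<lambda>G. G xs) (hd # map (\<lambda>i xs. xs ! Suc (m + i)) [0..<k]))))
           = (of_bool (Q (hd xs) ((tl ^^ Suc m) xs)) :: nat)" by simp
      qed
    qed
    show "decidable (Suc (Suc k)) (\<lambda>ys. Q (hd ys) (tl (tl ys)))"
      using *[of 1] by simp
    show "decidable (Suc (Suc (Suc k))) (\<lambda>ys. Q (hd ys) (tl (tl (tl ys))))"
      using *[of 2] by (simp add: numeral_2_eq_2)
  qed auto
  fix xs :: "nat list" assume "length xs = k"
  from ex[OF this] obtain i where i: "i \<le> N xs" "Q i xs" by auto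
  let ?m = "LEAST i. Q i xs"
  have m: "?m \<le> i" using i(2) by (rule Least_le)
  have Q: "Q ?m xs" using i(2) by (rule LeastI)
  have "{i. i < N xs \<and> (\<forall>j\<le>i. \<not> Q j xs)} = {..<?m}"
  proof -
    have "(\<forall>j\<le>l. \<not> Q j xs) \<longleftrightarrow> l < ?m" for l
      using not_less_Least[of _ "\<lambda>i. Q i xs"] Q by (meson le_less_trans not_le)
    then show ?thesis using m i(1) by auto
  qed
  then show "card {i. i < N xs \<and> (\<forall>j\<le>i. \<not> Q j xs)} = ?m" by simp
qed

lemma definable_funpow:
  assumes f: "definable 1 (\<lambda>xs. f (hd xs))" and "definable k N" "definable k F"
  shows "definable k (\<lambda>xs. (f ^^ N xs) (F xs))"
proof (rule definable_cong)
  show "definable k (\<lambda>xs. rec_nat (F xs) (\<lambda>_ y. f y) (N xs))"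
    by (intro definable_rec definable_base definable_app1[OF f] assms) auto
  have "rec_nat x (\<lambda>_ y. f y) n = (f ^^ n) x" for x n by (induction n) auto
  then show "rec_nat (F xs) (\<lambda>_ y. f y) (N xs) = (f ^^ N xs) (F xs)" for xs .
qed

section \<open>Coding of pairs\<close>

lemma definable_triangle: "definable k F \<Longrightarrow> definable k (\<lambda>xs. triangle (F xs))"
proof (rule definable_cong)
  show "definable k F \<Longrightarrow> definable k (\<lambda>xs. rec_nat 0 (\<lambda>n y. y + Suc n) (F xs))"
    by (intro definable_rec definable_add definable_base) auto
  have "rec_nat 0 (\<lambda>n y. y + Suc n) n = triangle n" for n by (induction n) auto
  then show "rec_nat 0 (\<lambda>n y. y + Suc n) (F xs) = triangle (F xs)" for xs .
qed

lemma definable_prod_encode: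
  "definable k F \<Longrightarrow> definable k G \<Longrightarrow> definable k (\<lambda>xs. prod_encode (F xs, G xs))"
  unfolding prod_encode_def by (auto intro!: definable_add definable_triangle)

text \<open>The components of a pair do not exceed its code, so decoding is a bounded
  search.\<close>

lemma definable_fst:
  assumes F: "definable k F"
  shows "definable k (\<lambda>xs. fst (prod_decode (F xs)))"
proof (rule definable_app1[OF _ F], rule definable_cong)
  have "\<exists>i\<le>x. \<exists>j\<le>x. prod_encode (i, j) = x" for x
    by (metis le_prod_encode_1 le_prod_encode_2 prod.collapse prod_decode_inverse)
  then show "definable 1 (\<lambda>xs. LEAST i. \<exists>j\<le>hd xs. prod_encode (i, j) = hd xs)"
    by (intro definable_Least[where N = hd] definable_prod_encode definable_base decidable_bex_le
        decidable_eq) auto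
  fix xs :: "nat list"
  show "(LEAST i. \<exists>j\<le>hd xs. prod_encode (i, j) = hd xs) = fst (prod_decode (hd xs))"
  proof (rule Least_equality)
    show "\<exists>j\<le>hd xs. prod_encode (fst (prod_decode (hd xs)), j) = hd xs"
      by (metis le_prod_encode_2 prod.collapse prod_decode_inverse)
    show "fst (prod_decode (hd xs)) \<le> y" if "\<exists>j\<le>hd xs. prod_encode (y, j) = hd xs" for y
      using that by (metis fst_conv order_refl prod_encode_inverse)
  qed
qed

lemma definable_snd:
  assumes F: "definable k F"
  shows "definable k (\<lambda>xs. snd (prod_decode (F xs)))"
proof (rule definable_app1[OF _ F], rule definable_cong)
  have "\<exists>i\<le>x. prod_encode (fst (prod_decode x), i) = x" for x
    by (metis le_prod_encode_2 prod.collapse prod_decode_inverse)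
  then show "definable 1 (\<lambda>xs. LEAST j. prod_encode (fst (prod_decode (hd xs)), j) = hd xs)"
    by (intro definable_Least[where N = hd] definable_prod_encode definable_fst definable_base
        decidable_eq) auto
  fix xs :: "nat list"
  show "(LEAST j. prod_encode (fst (prod_decode (hd xs)), j) = hd xs) = snd (prod_decode (hd xs))"
  proof (rule Least_equality)
    show "prod_encode (fst (prod_decode (hd xs)), snd (prod_decode (hd xs))) = hd xs" by simp
    show "snd (prod_decode (hd xs)) \<le> y" if "prod_encode (fst (prod_decode (hd xs)), y) = hd xs" for y
      using that by (metis snd_conv order_refl prod_encode_inverse)
  qed
qed

lemma decidable_even:
  assumes F: "definable k F"
  shows "decidable k (\<lambda>xs. even (F xs))"
proof (rule definable_cong)
  show "decidable k (\<lambda>xs. \<exists>i\<le>F xs. i + i = F xs)"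
    by (intro decidable_bex_le decidable_eq definable_add definable_base definable_weaken F) auto
  have "(\<exists>i\<le>n. i + i = n) \<longleftrightarrow> even n" for n :: nat
    by (auto elim!: evenE intro!: exI[of _ "n div 2"])
  then show "of_bool (\<exists>i\<le>F xs. i + i = F xs) = (of_bool (even (F xs)) :: nat)" for xs
    by simp
qed

lemmas definable_intros = definable_base definable_add definable_diff definable_if decidable_not
  decidable_conj decidable_disj decidable_imp decidable_le decidable_less decidable_eq decidable_ball
  decidable_bex decidable_ball_le decidable_bex_le definable_prod_encode definable_fst definable_snd
  decidable_even

end


section \<open>Primitive recursive functions, those with an oracle, and computable functions\<close>

context scheme_class
begin

lemma ok_pr: "mu_free e \<Longrightarrow> oracle_free e \<Longrightarrow> ok e"
  by (induction e) (auto intro: ok_Zero ok_Succ ok_Proj ok_Comp ok_PrimRec)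

end

abbreviation pr_definable where
  "pr_definable \<equiv> scheme_class.definable (\<lambda>e. mu_free e \<and> oracle_free e) UNIV"

abbreviation opr_definable where
  "opr_definable g \<equiv> scheme_class.definable mu_free {g}"

abbreviation rec_definable where
  "rec_definable X \<equiv> scheme_class.definable (\<lambda>_. True) {X}"

abbreviation pr_decidable where
  "pr_decidable k R \<equiv> pr_definable k (\<lambda>xs. of_bool (R xs))"

abbreviation rec_decidable where
  "rec_decidable X k R \<equiv> rec_definable X k (\<lambda>xs. of_bool (R xs))"

interpretation pr: scheme_class "\<lambda>e. mu_free e \<and> oracle_free e" UNIV
  by unfold_locales auto

interpretation opr: scheme_class mu_free "{g}" for g
  by unfold_locales auto

interpretation rec: scheme_class "\<lambda>_. True" "{X}" for X
  by unfold_locales auto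

lemma (in scheme_class) definable_pr: "pr_definable k F \<Longrightarrow> definable k F"
  unfolding pr.definable_def definable_def using ok_pr by blast

lemma primitive_recursive_iff:
  "primitive_recursive f \<longleftrightarrow> pr_definable 1 (\<lambda>xs. f (hd xs))"
proof -
  have "(\<forall>X x. evals X e [x] (f x)) \<longleftrightarrow> (\<forall>X\<in>UNIV. \<forall>xs. length xs = 1 \<longrightarrow> evals X e xs (f (hd xs)))" for e
    by (force simp: length_Suc_conv dest: spec[of _ "[_]"])
  then show ?thesis unfolding primitive_recursive_def pr.definable_def by simp
qed

lemma pr_le_iff: "f \<le>PR g \<longleftrightarrow> opr_definable g 1 (\<lambda>xs. f (hd xs))"
proof -
  have "(\<forall>x. evals g e [x] (f x)) \<longleftrightarrow> (\<forall>X\<in>{g}. \<forall>xs. length xs = 1 \<longrightarrow> evals X e xs (f (hd xs)))" for e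
    by (auto simp: length_Suc_conv)
  then show ?thesis unfolding pr_le_def opr.definable_def by simp
qed

lemma computable_rel_iff: "computable_rel X k R \<longleftrightarrow> rec_decidable X k R"
  unfolding computable_rel_def rec.definable_def by simp

lemma rec_definable_oracle: "rec_definable X 1 (\<lambda>xs. X (hd xs))"
  unfolding rec.definable_def
  by (intro exI[of _ Oracle]) (auto simp: length_Suc_conv intro: evals_Oracle)

lemma rec_definable_Least:
  assumes Q: "rec_decidable X (Suc k) (\<lambda>ys. Q (hd ys) (tl ys))"
    and ex: "\<And>xs. length xs = k \<Longrightarrow> \<exists>i. Q i xs"
  shows "rec_definable X k (\<lambda>xs. LEAST i. Q i xs)"
proof -
  \<comment> \<open>\<open>Mu\<close> stops at the value 0, so the search runs over a scheme for the
    negation.\<close>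
  from rec.decidable_not[OF Q] obtain e where e: "has_arity (Suc k) e"
    "\<And>ys. length ys = Suc k \<Longrightarrow> evals X e ys (of_bool (\<not> Q (hd ys) (tl ys)))"
    unfolding rec.definable_def by auto
  have "evals X (Mu e) xs (LEAST i. Q i xs)" if xs: "length xs = k" for xs
  proof (rule evals_Mu)
    have "Q (LEAST i. Q i xs) xs" using ex[OF xs] by (rule LeastI_ex)
    then show "evals X e ((LEAST i. Q i xs) # xs) 0" using e(2)[of "(LEAST i. Q i xs) # xs"] xs by simp
    fix z assume "z < (LEAST i. Q i xs)"
    then have "\<not> Q z xs" by (rule not_less_Least)
    then show "\<exists>v. evals X e (z # xs) (Suc v)" using e(2)[of "z # xs"] xs by auto
  qed
  then show ?thesis unfolding rec.definable_def by (intro exI[of _ "Mu e"]) (use e in auto)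
qed

section \<open>Oracle substitution\<close>

fun oracle_subst :: "scheme \<Rightarrow> scheme \<Rightarrow> scheme" where
  "oracle_subst s Oracle = s"
| "oracle_subst s (Comp h gs) = Comp (oracle_subst s h) (map (oracle_subst s) gs)"
| "oracle_subst s (PrimRec g h) = PrimRec (oracle_subst s g) (oracle_subst s h)"
| "oracle_subst s (Mu e) = Mu (oracle_subst s e)"
| "oracle_subst s e = e"

lemma has_arity_oracle_subst:
  "has_arity 1 s \<Longrightarrow> has_arity k e \<Longrightarrow> has_arity k (oracle_subst s e)"
  by (induction e arbitrary: k) auto

lemma mu_free_oracle_subst: "mu_free s \<Longrightarrow> mu_free e \<Longrightarrow> mu_free (oracle_subst s e)"
  by (induction e) auto

lemma evals_oracle_subst:
  assumes "evals Y e xs y" and s: "\<And>x. evals X s [x] (Y x)"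
  shows "evals X (oracle_subst s e) xs y"
  using assms(1)
proof (induction rule: evals.induct)
  case (evals_Comp xs gs ys h z)
  then have "list_all2 (\<lambda>g y. evals X g xs y) (map (oracle_subst s) gs) ys"
    by (auto simp: list_all2_conv_all_nth)
  then show ?case using evals_Comp by (auto intro: evals.intros)
next
  case (evals_Mu e y xs)
  then show ?case by (auto intro!: evals.evals_Mu)
qed (auto intro: evals.intros s)

lemma opr_definable_trans:
  assumes F: "opr_definable h k F" and h: "h \<le>PR g"
  shows "opr_definable g k F"
proof -
  from h obtain s where "has_arity 1 s" "mu_free s" "\<And>x. evals g s [x] (h x)"
    unfolding pr_le_def by metis
  moreover from F obtain e where "has_arity k e" "mu_free e"
    "\<And>xs. length xs = k \<Longrightarrow> evals h e xs (F xs)"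
    unfolding opr.definable_def by auto
  ultimately show ?thesis unfolding opr.definable_def
    by (intro exI[of _ "oracle_subst s e"])
      (auto intro: has_arity_oracle_subst mu_free_oracle_subst evals_oracle_subst)
qed

lemma rec_definable_trans:
  assumes F: "rec_definable Y k F" and Y: "rec_definable X 1 (\<lambda>xs. Y (hd xs))"
  shows "rec_definable X k F"
proof -
  from Y obtain s where "has_arity 1 s" "\<And>xs. length xs = 1 \<Longrightarrow> evals X s xs (Y (hd xs))"
    unfolding rec.definable_def by auto
  then have "has_arity 1 s" "\<And>x. evals X s [x] (Y x)" by (metis One_nat_def length_Cons list.sel(1) list.size(3))+
  moreover from F obtain e where "has_arity k e" "\<And>xs. length xs = k \<Longrightarrow> evals Y e xs (F xs)"
    unfolding rec.definable_def by auto
  ultimately show ?thesis unfolding rec.definable_def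
    by (intro exI[of _ "oracle_subst s e"]) (auto intro: has_arity_oracle_subst evals_oracle_subst)
qed

lemma pr_le_refl: "g \<le>PR g"
  unfolding pr_le_def by (intro exI[of _ Oracle]) (auto intro: evals_Oracle)

lemma pr_le_trans: "f \<le>PR h \<Longrightarrow> h \<le>PR g \<Longrightarrow> f \<le>PR g"
  unfolding pr_le_iff[of f] by (rule opr_definable_trans)

lemma pr_le_comp:
  assumes "f \<le>PR g" "h \<le>PR g"
  shows "(f \<circ> h) \<le>PR g"
  using opr.definable_app1[of g f 1 "\<lambda>xs. h (hd xs)"] assms unfolding pr_le_iff by simp

lemma pr_degrees_cases:
  assumes "d \<in> pr_degrees"
  obtains g where "\<And>f. pr_le_degree f d \<longleftrightarrow> f \<le>PR g"
proof -
  from assms obtain g where d: "d = {(f, g). f \<equiv>PR g} `` {g}"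
    unfolding pr_degrees_def by (elim quotientE) auto
  have "pr_le_degree f d \<longleftrightarrow> f \<le>PR g" for f
    unfolding pr_le_degree_def d pr_equiv_def using pr_le_trans[of f _ g] pr_le_refl by auto
  then show thesis by (rule that)
qed

section \<open>The arithmetical hierarchy relative to an oracle\<close>

lemma computable_rel_trans:
  assumes "computable_rel Y k R" "rec_definable X 1 (\<lambda>xs. Y (hd xs))"
  shows "computable_rel X k R"
  using assms unfolding computable_rel_iff by (rule rec_definable_trans)

lemma Sigma_Pi_rel_trans:
  assumes X: "rec_definable X 1 (\<lambda>xs. Y (hd xs))"
  shows "(Sigma_rel n Y k R \<longrightarrow> Sigma_rel n X k R) \<and> (Pi_rel n Y k R \<longrightarrow> Pi_rel n X k R)"
proof (induction n arbitrary: k R)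
  case 0
  then show ?case using computable_rel_trans[OF _ X] by simp
next
  case (Suc n)
  then show ?case by auto
qed

lemma Delta_fun_in_trans:
  assumes "Delta_fun_in n Y f" "rec_definable X 1 (\<lambda>xs. Y (hd xs))"
  shows "Delta_fun_in n X f"
  using assms Sigma_Pi_rel_trans unfolding Delta_fun_in_def Delta_rel_def by blast

text \<open>The first \<open>j\<close> entries are the bound variables.\<close>

definition swap_after :: "nat \<Rightarrow> nat list \<Rightarrow> nat list" where
  "swap_after j xs = take j xs @ [xs ! Suc j, xs ! j]"

lemma rec_definable_swap_after:
  assumes "rec_definable X (Suc (Suc j)) F"
  shows "rec_definable X (Suc (Suc j)) (\<lambda>xs. F (swap_after j xs))"
proof -
  let ?Gs = "map (\<lambda>i xs. xs ! i) [0..<j] @ [\<lambda>xs. xs ! Suc j, \<lambda>xs. xs ! j]"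
  have "rec_definable X (Suc (Suc j)) (\<lambda>xs. F (map (\<lambda>G. G xs) ?Gs))"
    by (rule rec.definable_compose) (use assms in \<open>auto intro!: rec.definable_nth\<close>)
  then show ?thesis
  proof (rule rec.definable_cong[rotated])
    fix xs :: "nat list" assume "length xs = Suc (Suc j)"
    then have "map (\<lambda>G. G xs) (map (\<lambda>i xs. xs ! i) [0..<j]) = take j xs"
      by (auto intro!: nth_equalityI)
    then show "F (map (\<lambda>G. G xs) ?Gs) = F (swap_after j xs)"
      unfolding swap_after_def map_append by simp
  qed
qed

lemma Sigma_Pi_rel_swap_after:
  "(Sigma_rel n X (Suc (Suc j)) R \<longrightarrow> Sigma_rel n X (Suc (Suc j)) (\<lambda>xs. R (swap_after j xs))) \<and>
   (Pi_rel n X (Suc (Suc j)) R \<longrightarrow> Pi_rel n X (Suc (Suc j)) (\<lambda>xs. R (swap_after j xs)))"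
proof (induction n arbitrary: j R)
  case 0
  then show ?case by (auto simp: computable_rel_iff intro: rec_definable_swap_after)
next
  case (Suc n)
  have *: "swap_after (Suc j) (y # xs) = y # swap_after j xs" for y xs
    by (simp add: swap_after_def)
  have len: "length (swap_after j xs) = Suc (Suc j)" if "length xs = Suc (Suc j)" for xs
    using that by (simp add: swap_after_def)
  show ?case
  proof (intro conjI impI)
    assume "Sigma_rel (Suc n) X (Suc (Suc j)) R"
    then obtain Q where Q: "Pi_rel n X (Suc (Suc (Suc j))) Q"
      "\<And>xs. length xs = Suc (Suc j) \<Longrightarrow> R xs \<longleftrightarrow> (\<exists>y. Q (y # xs))" by auto
    then show "Sigma_rel (Suc n) X (Suc (Suc j)) (\<lambda>xs. R (swap_after j xs))"
      using Suc[of "Suc j" Q] len by (auto simp: * intro!: exI[of _ "\<lambda>xs. Q (swap_after (Suc j) xs)"])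
  next
    assume "Pi_rel (Suc n) X (Suc (Suc j)) R"
    then obtain Q where Q: "Sigma_rel n X (Suc (Suc (Suc j))) Q"
      "\<And>xs. length xs = Suc (Suc j) \<Longrightarrow> R xs \<longleftrightarrow> (\<forall>y. Q (y # xs))" by auto
    then show "Pi_rel (Suc n) X (Suc (Suc j)) (\<lambda>xs. R (swap_after j xs))"
      using Suc[of "Suc j" Q] len by (auto simp: * intro!: exI[of _ "\<lambda>xs. Q (swap_after (Suc j) xs)"])
  qed
qed

text \<open>The graph of the inverse is the transposed graph. This is what the exchange of the last
  two arguments, carried through all quantifiers, was prepared for.\<close>

lemma Delta_fun_inv:
  assumes "Delta_fun n h" "bij h"
  shows "Delta_fun n (inv h)"
proof -
  have *: "inv h (xs ! 0) = xs ! 1 \<longleftrightarrow> h (swap_after 0 xs ! 0) = swap_after 0 xs ! 1"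
    for xs :: "nat list"
    using assms(2) by (simp add: swap_after_def) (metis bij_inv_eq_iff)
  show ?thesis
    using assms(1) Sigma_Pi_rel_swap_after[of n _ 0 "\<lambda>xs. h (xs ! 0) = xs ! 1"]
    unfolding Delta_fun_def Delta_fun_in_def Delta_rel_def * by (simp add: numeral_2_eq_2)
qed

text \<open>A total function whose graph is Sigma 1 also has a Pi 1 graph: \<open>f x = y\<close>
  iff every value witnessed at \<open>x\<close> equals \<open>y\<close>. In the universal form one
  number \<open>z\<close> codes both the witness and the value.\<close>

lemma Delta_fun_in_1I:
  assumes Q: "rec_decidable X 3 (\<lambda>xs. Q (hd xs) (hd (tl xs)) (hd (tl (tl xs))))"
    and graph: "\<And>x y. f x = y \<longleftrightarrow> (\<exists>w. Q w x y)"
  shows "Delta_fun_in 1 X f"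
proof -
  have 2: "length xs = 2 \<longleftrightarrow> (\<exists>x y. xs = [x, y])" for xs :: "nat list"
    by (auto simp: numeral_2_eq_2 length_Suc_conv)
  have "rec_decidable X 3 (\<lambda>xs. Q (fst (prod_decode (hd xs))) (hd (tl xs)) (snd (prod_decode (hd xs)))
      \<longrightarrow> snd (prod_decode (hd xs)) = hd (tl (tl xs)))"
    by (intro rec.definable_intros
        rec.definable_app3[where f = "\<lambda>a b c. of_bool (Q a b c)", OF Q]) auto
  moreover have "f x = y \<longleftrightarrow> (\<forall>z. Q (fst (prod_decode z)) x (snd (prod_decode z))
      \<longrightarrow> snd (prod_decode z) = y)" for x y
    using graph by (metis fst_conv snd_conv prod_encode_inverse)
  ultimately have "Pi_rel 1 X 2 (\<lambda>xs. f (xs ! 0) = xs ! 1)"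
    by (auto simp: computable_rel_iff 2 numeral_3_eq_3 intro!: exI[of _ "\<lambda>xs. Q (fst (prod_decode (hd xs))) (hd (tl xs)) (snd (prod_decode (hd xs)))
      \<longrightarrow> snd (prod_decode (hd xs)) = hd (tl (tl xs))"] simp del: prod_encode_inverse)
  moreover have "Sigma_rel 1 X 2 (\<lambda>xs. f (xs ! 0) = xs ! 1)"
    using Q by (auto simp: computable_rel_iff 2 graph numeral_3_eq_3
        intro!: exI[of _ "\<lambda>xs. Q (hd xs) (hd (tl xs)) (hd (tl (tl xs)))"])
  ultimately show ?thesis unfolding Delta_fun_in_def Delta_rel_def by simp
qed

section \<open>The atomic diagram: its complexity and its use as an oracle\<close>

lemma (in scheme_class) decidable_atomic_diagram:
  assumes B: "definable 1 (\<lambda>xs. B (hd xs))"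
  shows "definable 1 (\<lambda>xs. char_fun (atomic_diagram B) (hd xs))"
proof -
  define P where "P x \<longleftrightarrow> (let s = fst (prod_decode x); u = fst (prod_decode (snd (prod_decode x)));
      v = snd (prod_decode (snd (prod_decode x)));
      e = ((B ^^ fst (prod_decode u)) (snd (prod_decode u)) = (B ^^ fst (prod_decode v)) (snd (prod_decode v)))
    in s = 0 \<and> e \<or> s = 1 \<and> \<not> e)" for x
  have "x \<in> atomic_diagram B \<longleftrightarrow> P x" for x
  proof -
    \<comment> \<open>Every number has this form once \<open>s\<close> is arbitrary; codes with
      \<open>s > 1\<close> lie outside the diagram.\<close>
    obtain s k a l b where x: "x = literal_code s k a l b"
      unfolding literal_code_def by (metis prod.collapse prod_decode_inverse)
    show ?thesis unfolding atomic_diagram_def P_def x Let_def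
      by (auto simp: literal_code_def)
  qed
  then have "char_fun (atomic_diagram B) x = of_bool (P x)" for x
    by (simp add: char_fun_def)
  then have eq: "(\<lambda>xs. char_fun (atomic_diagram B) (hd xs)) = (\<lambda>xs. of_bool (P (hd xs)))"
    by simp
  show ?thesis unfolding eq P_def Let_def
    by (intro definable_intros definable_funpow[OF B]) auto
qed

text \<open>A search through the literals \<open>f(x) = y\<close>, coded with \<open>k = 1\<close>
  and \<open>l = 0\<close>, finds \<open>B x\<close>; it terminates because \<open>B\<close> is
  total.\<close>

lemma rec_definable_atomic_diagram:
  "rec_definable (char_fun (atomic_diagram B)) 1 (\<lambda>xs. B (hd xs))"
proof (rule rec.definable_cong)
  let ?X = "char_fun (atomic_diagram B)"
  have *: "literal_code 0 (Suc 0) x 0 y \<in> atomic_diagram B \<longleftrightarrow> B x = y" for x y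
    by (auto simp: atomic_diagram_def literal_code_def intro!: exI[of _ "Suc 0"] exI[of _ x] exI[of _ 0] exI[of _ y])
  have "rec_definable ?X 1 (\<lambda>xs. LEAST y. ?X (literal_code 0 (Suc 0) (hd xs) 0 y) = 1)"
    by (rule rec_definable_Least, unfold literal_code_def,
       intro rec.definable_intros rec.definable_app1[OF rec_definable_oracle],
       auto simp: char_fun_def *[unfolded literal_code_def])
  then show "rec_definable ?X 1 (\<lambda>xs. LEAST y. ?X (literal_code 0 (Suc 0) (hd xs) 0 y) = 1)" .
  show "(LEAST y. ?X (literal_code 0 (Suc 0) (hd xs) 0 y) = 1) = B (hd xs)" for xs
    by (rule Least_equality) (auto simp: char_fun_def * of_bool_def split: if_splits)
qed


section \<open>Limit approximation of \<open>\<Delta>\<^sup>0\<^sub>2\<close> functions\<close>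

text \<open>Evaluation with the constant zero oracle and with \<open>s\<close> bounding every unbounded search: the
  result is 0 when a search exceeds \<open>s\<close> and \<open>Suc y\<close> when the value is \<open>y\<close>.\<close>

fun run :: "nat \<Rightarrow> scheme \<Rightarrow> nat list \<Rightarrow> nat" where
  "run s Zero xs = 1"
| "run s Succ xs = Suc (Suc (hd xs))"
| "run s (Proj i) xs = Suc (xs ! i)"
| "run s Oracle xs = 1"
| "run s (Comp h gs) xs =
     (if \<forall>g\<in>set gs. run s g xs \<noteq> 0 then run s h (map (\<lambda>g. run s g xs - 1) gs) else 0)"
| "run s (PrimRec g h) xs =
     rec_nat (run s g (tl xs)) (\<lambda>n r. if r = 0 then 0 else run s h (n # (r - 1) # tl xs)) (hd xs)"
| "run s (Mu e) xs = (let m = LEAST y. y = s \<or> run s e (y # xs) \<le> 1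
     in if m < s \<and> run s e (m # xs) = 1 then Suc m else 0)"

lemma (in scheme_class) definable_reindex:
  assumes "definable m H" "length Gs = m" "\<And>G. G \<in> set Gs \<Longrightarrow> definable k G"
    "\<And>xs. length xs = k \<Longrightarrow> L xs = map (\<lambda>G. G xs) Gs"
  shows "definable k (\<lambda>xs. H (L xs))"
  using definable_cong[OF _ definable_compose[of Gs H k]] assms by auto

lemma (in scheme_class) decidable_Ball_list:
  "(\<And>g. g \<in> set gs \<Longrightarrow> decidable k (P g)) \<Longrightarrow> decidable k (\<lambda>xs. \<forall>g\<in>set gs. P g xs)"
proof (induction gs)
  case Nil
  then show ?case using definable_const[of k 1] by simp
next
  case (Cons g gs)
  then have "decidable k (\<lambda>xs. P g xs \<and> (\<forall>g\<in>set gs. P g xs))"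
    by (intro decidable_conj) auto
  then show ?case by simp
qed

text \<open>Each fixed scheme is treated on its own by induction, so no universal evaluator occurs;
  the stage bound turns every search into a bounded one.\<close>

lemma pr_definable_run:
  "has_arity k e \<Longrightarrow> pr_definable (Suc k) (\<lambda>ys. run (hd ys) e (tl ys))"
proof (induction e arbitrary: k)
  case (Comp h gs)
  let ?Gs = "hd # map (\<lambda>g ys. run (hd ys) g (tl ys) - 1) gs"
  have h: "pr_definable (Suc (length gs)) (\<lambda>ys. run (hd ys) h (tl ys))" using Comp by simp
  have g: "pr_definable (Suc k) (\<lambda>ys. run (hd ys) g (tl ys))" if "g \<in> set gs" for g
    using Comp that by simp
  have "pr_definable (Suc k) (\<lambda>ys. (\<lambda>zs. run (hd zs) h (tl zs))
    (hd ys # map (\<lambda>g. run (hd ys) g (tl ys) - 1) gs))"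
    by (rule pr.definable_reindex[OF h, where Gs = ?Gs]) (use g in \<open>auto intro!: pr.definable_intros\<close>)
  then have 1: "pr_definable (Suc k) (\<lambda>ys. run (hd ys) h (map (\<lambda>g. run (hd ys) g (tl ys) - 1) gs))"
    by simp
  show ?case unfolding run.simps
    by (intro pr.definable_if pr.decidable_Ball_list 1 pr.decidable_not pr.decidable_eq g
        pr.definable_const)
next
  case (PrimRec g h)
  then obtain m where m: "k = Suc m" "has_arity m g" "has_arity (Suc (Suc m)) h" by auto
  have "pr_definable (Suc k) (\<lambda>ys. (\<lambda>zs. run (hd zs) g (tl zs)) (hd ys # tl (tl ys)))"
    by (rule pr.definable_reindex[OF PrimRec.IH(1)[OF m(2)],
          where Gs = "hd # map (\<lambda>i ys. ys ! Suc (Suc i)) [0..<m]"])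
      (use m(1) in \<open>auto intro!: pr.definable_intros nth_equalityI simp: nth_tl\<close>)
  then have g: "pr_definable (Suc k) (\<lambda>ys. run (hd ys) g (tl (tl ys)))" by simp
  have "pr_definable (Suc (Suc (Suc k))) (\<lambda>ys. (\<lambda>zs. run (hd zs) h (tl zs))
     (hd (tl (tl ys)) # hd ys # (hd (tl ys) - 1) # tl (tl (tl (tl ys)))))"
    by (rule pr.definable_reindex[OF PrimRec.IH(2)[OF m(3)],
          where Gs = "(\<lambda>ys. hd (tl (tl ys))) # hd # (\<lambda>ys. hd (tl ys) - 1) #
            map (\<lambda>i ys. ys ! Suc (Suc (Suc (Suc i)))) [0..<m]"])
      (use m(1) in \<open>auto intro!: pr.definable_intros nth_equalityI simp: nth_tl\<close>)
  then have h: "pr_definable (Suc (Suc (Suc k))) (\<lambda>ys. run (hd (tl (tl ys))) h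
     (hd ys # (hd (tl ys) - 1) # tl (tl (tl (tl ys)))))" by simp
  show ?case unfolding run.simps
    by (intro pr.definable_rec g h pr.definable_intros) (use m(1) in auto)
next
  case (Mu e)
  then have e: "has_arity (Suc k) e" by simp
  have "pr_definable (Suc (Suc k)) (\<lambda>ys. (\<lambda>zs. run (hd zs) e (tl zs)) (hd (tl ys) # hd ys # tl (tl ys)))"
    by (rule pr.definable_reindex[OF Mu.IH[OF e],
          where Gs = "(\<lambda>ys. hd (tl ys)) # hd # map (\<lambda>i ys. ys ! Suc (Suc i)) [0..<k]"])
      (auto intro!: pr.definable_intros nth_equalityI simp: nth_tl)
  then have 1: "pr_definable (Suc (Suc k)) (\<lambda>ys. run (hd (tl ys)) e (hd ys # tl (tl ys)))" by simp
  \<comment> \<open>The disjunct \<open>y = s\<close> of \<open>run\<close> gives the search a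
    solution at the stage bound, whatever the scheme does.\<close>
  have m: "pr_definable (Suc k) (\<lambda>ys. LEAST y. y = hd ys \<or> run (hd ys) e (y # tl ys) \<le> 1)"
    by (rule pr.definable_Least[where N = hd], intro pr.definable_intros,
        simp, intro pr.definable_intros 1) auto
  let ?m = "\<lambda>ys. LEAST y. y = hd ys \<or> run (hd ys) e (y # tl ys) \<le> 1"
  have "pr_definable (Suc k) (\<lambda>ys. (\<lambda>zs. run (hd zs) e (tl zs)) (hd ys # ?m ys # tl ys))"
    by (rule pr.definable_reindex[OF Mu.IH[OF e], where Gs = "hd # ?m # map (\<lambda>i ys. ys ! Suc i) [0..<k]"])
      (use m in \<open>auto intro!: pr.definable_intros nth_equalityI simp: nth_tl\<close>)
  then have 2: "pr_definable (Suc k) (\<lambda>ys. run (hd ys) e (?m ys # tl ys))" by simp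
  show ?case unfolding run.simps Let_def
    by (intro pr.definable_intros 2 m) auto
qed (auto intro!: pr.definable_intros)

lemma run_sound:
  "has_arity k e \<Longrightarrow> length xs = k \<Longrightarrow> run s e xs = Suc y \<Longrightarrow> evals (\<lambda>_. 0) e xs y"
proof (induction e arbitrary: k xs y)
  case Succ
  then show ?case by (auto simp: length_Suc_conv intro: evals_Succ)
next
  case Oracle
  then show ?case using evals_Oracle[of "\<lambda>_. 0"] by (auto simp: length_Suc_conv)
next
  case (Comp h gs)
  from Comp.prems have g: "\<forall>g\<in>set gs. run s g xs \<noteq> 0" and h: "run s h (map (\<lambda>g. run s g xs - 1) gs) = Suc y"
    by (auto split: if_splits)
  have "list_all2 (\<lambda>g y. evals (\<lambda>_. 0) g xs y) gs (map (\<lambda>g. run s g xs - 1) gs)"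
    unfolding list_all2_conv_all_nth
  proof (intro conjI allI impI)
    fix i assume i: "i < length gs"
    then have "run s (gs ! i) xs = Suc (run s (gs ! i) xs - 1)" using g by auto
    then show "evals (\<lambda>_. 0) (gs ! i) xs (map (\<lambda>g. run s g xs - 1) gs ! i)"
      using Comp.IH(2)[of "gs ! i" k xs] Comp.prems i by simp
  qed simp
  then show ?case using Comp.IH(1)[OF _ _ h] Comp.prems by (auto intro: evals_Comp)
next
  case (PrimRec g h)
  then obtain n zs where xs: "xs = n # zs" and k: "k = Suc (length zs)"
    "has_arity (length zs) g" "has_arity (Suc (Suc (length zs))) h" by (cases xs) auto
  have "rec_nat (run s g zs) (\<lambda>n r. if r = 0 then 0 else run s h (n # (r - 1) # zs)) n = Suc y
    \<Longrightarrow> evals (\<lambda>_. 0) (PrimRec g h) (n # zs) y" for y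
  proof (induction n arbitrary: y)
    case 0
    then show ?case using PrimRec.IH(1)[OF k(2)] by (auto intro: evals_PrimRec_0)
  next
    case (Suc n)
    let ?r = "rec_nat (run s g zs) (\<lambda>n r. if r = 0 then 0 else run s h (n # (r - 1) # zs)) n"
    from Suc.prems have r: "?r \<noteq> 0" "run s h (n # (?r - 1) # zs) = Suc y" by (auto split: if_splits)
    then show ?case using Suc.IH[of "?r - 1"] PrimRec.IH(2)[OF k(3) _ r(2)]
      by (auto intro: evals_PrimRec_Suc)
  qed
  then show ?case using PrimRec.prems(3) unfolding xs run.simps list.sel by simp
next
  case (Mu e)
  let ?Q = "\<lambda>y. y = s \<or> run s e (y # xs) \<le> 1"
  let ?m = "LEAST y. ?Q y"
  have m: "?m < s" "run s e (?m # xs) = 1" "y = ?m"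
    using Mu.prems(3) by (auto simp: Let_def split: if_splits)
  show ?case unfolding m(3)
  proof (rule evals_Mu)
    show "evals (\<lambda>_. 0) e (?m # xs) 0" using Mu.IH[of "Suc k"] Mu.prems m by auto
    fix z assume "z < ?m"
    then have "\<not> ?Q z" by (rule not_less_Least)
    then obtain v where "run s e (z # xs) = Suc (Suc v)"
      by (metis One_nat_def Suc_leI le_0_eq not0_implies_Suc not_less_eq_eq not_le)
    then show "\<exists>v. evals (\<lambda>_. 0) e (z # xs) (Suc v)" using Mu.IH[of "Suc k" "z # xs" "Suc v"] Mu.prems by auto
  qed
qed (auto intro: evals.intros)

text \<open>A converging computation performs finitely many searches, so all large bounds suffice.
  The form "for all \<open>s\<close> from some \<open>s0\<close> on" also yields determinism: two
  values of one computation would both be returned by \<open>run\<close> at a common stage.\<close>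

lemma run_complete: "evals (\<lambda>_. 0) e xs y \<Longrightarrow> \<exists>s0. \<forall>s\<ge>s0. run s e xs = Suc y"
proof (induction rule: evals.induct)
  case (evals_Comp xs gs ys h z)
  then have len: "length gs = length ys" and
    "\<forall>i<length gs. \<exists>s0. \<forall>s\<ge>s0. run s (gs ! i) xs = Suc (ys ! i)"
    by (auto simp: list_all2_conv_all_nth)
  then obtain S where S: "\<And>i s. i < length gs \<Longrightarrow> s \<ge> S i \<Longrightarrow> run s (gs ! i) xs = Suc (ys ! i)"
    by metis
  from evals_Comp obtain s1 where s1: "\<And>s. s \<ge> s1 \<Longrightarrow> run s h ys = Suc z" by auto
  \<comment> \<open>The sum is a common upper bound of the finitely many stages
    \<open>S i\<close>.\<close>
  have "run s (Comp h gs) xs = Suc z" if "s \<ge> s1 + (\<Sum>i<length gs. S i)" for s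
  proof -
    have "s \<ge> S i" if "i < length gs" for i
      using member_le_sum[of i "{..<length gs}" S] that \<open>s \<ge> _\<close> by auto
    then have *: "run s (gs ! i) xs = Suc (ys ! i)" if "i < length gs" for i
      using S that by auto
    then have "map (\<lambda>g. run s g xs - 1) gs = ys"
      using len by (auto intro: nth_equalityI)
    moreover have "\<forall>g\<in>set gs. run s g xs \<noteq> 0" using * by (metis Zero_not_Suc in_set_conv_nth)
    ultimately show ?thesis using s1 that by simp
  qed
  then show ?case by blast
next
  case (evals_PrimRec_Suc g h n xs y z)
  then obtain s0 s1 where "\<And>s. s \<ge> s0 \<Longrightarrow> run s (PrimRec g h) (n # xs) = Suc y"
    "\<And>s. s \<ge> s1 \<Longrightarrow> run s h (n # y # xs) = Suc z" by auto
  then have "run s (PrimRec g h) (Suc n # xs) = Suc z" if "s \<ge> s0 + s1" for s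
    using that unfolding run.simps list.sel by simp
  then show ?case by blast
next
  case (evals_Mu e y xs)
  from evals_Mu.IH(1) obtain s0 where s0: "\<And>s. s \<ge> s0 \<Longrightarrow> run s e (y # xs) = 1" by auto
  from evals_Mu.IH(2) have "\<forall>z<y. \<exists>v s0. \<forall>s\<ge>s0. run s e (z # xs) = Suc (Suc v)" by blast
  then obtain V S where S: "\<And>z s. z < y \<Longrightarrow> s \<ge> S z \<Longrightarrow> run s e (z # xs) = Suc (Suc (V z))" by metis
  \<comment> \<open>\<open>Suc y\<close> is included because \<open>run\<close> accepts the result
    of a search only if it is below \<open>s\<close>.\<close>
  have "run s (Mu e) xs = Suc y" if s: "s \<ge> Suc y + s0 + (\<Sum>i<y. S i)" for s
  proof -
    have "s \<ge> S i" if "i < y" for i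
      using member_le_sum[of i "{..<y}" S] that s by auto
    then have *: "run s e (z # xs) > 1" if "z < y" for z using S that by auto
    have "(LEAST y. y = s \<or> run s e (y # xs) \<le> 1) = y"
    proof (rule Least_equality)
      show "y = s \<or> run s e (y # xs) \<le> 1" using s0 s by auto
      show "y \<le> z" if "z = s \<or> run s e (z # xs) \<le> 1" for z
        using that * s by (metis Suc_leD add_leD1 not_le)
    qed
    then show ?thesis using s0 s by (simp add: Let_def)
  qed
  then show ?case by blast
qed auto

text \<open>The Sigma form exhibits \<open>f n\<close> as the only \<open>y\<close> for which some
  \<open>u\<close> passes every test \<open>v\<close>. The matrix is kept as a scheme, so that
  \<open>run\<close> can look for failing tests.\<close>

lemma Delta_fun_2_matrix:
  assumes "Delta_fun 2 f"
  obtains e where "has_arity 4 e"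
    "\<And>xs. length xs = 4 \<Longrightarrow> \<exists>b. evals (\<lambda>_. 0) e xs (of_bool b)"
    "\<And>n y. f n = y \<longleftrightarrow> (\<exists>u. \<forall>v. evals (\<lambda>_. 0) e [v, u, n, y] 1)"
proof -
  from assms have "Sigma_rel 2 (\<lambda>_. 0) 2 (\<lambda>xs. f (xs ! 0) = xs ! 1)"
    unfolding Delta_fun_def Delta_fun_in_def Delta_rel_def by simp
  then obtain P where "Pi_rel 1 (\<lambda>_. 0) 3 P"
    and f': "\<And>xs. length xs = 2 \<Longrightarrow> f (xs ! 0) = xs ! 1 \<longleftrightarrow> (\<exists>u. P (u # xs))"
    unfolding numeral_2_eq_2 numeral_3_eq_3 by auto
  then have "\<exists>Q. computable_rel (\<lambda>_. 0) 4 Q \<and> (\<forall>xs. length xs = 3 \<longrightarrow> P xs \<longleftrightarrow> (\<forall>v. Q (v # xs)))"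
    by (simp add: numeral_eq_Suc)
  then obtain Q where Q: "computable_rel (\<lambda>_. 0) 4 Q" and
    P: "\<And>xs. length xs = 3 \<Longrightarrow> P xs \<longleftrightarrow> (\<forall>v. Q (v # xs))" by blast
  have f: "f n = y \<longleftrightarrow> (\<exists>u. P [u, n, y])" for n y
    using f'[of "[n, y]"] by simp
  from Q obtain e where e: "has_arity 4 e" "\<And>xs. length xs = 4 \<Longrightarrow> evals (\<lambda>_. 0) e xs (of_bool (Q xs))"
    unfolding computable_rel_def by auto
  have "evals (\<lambda>_. 0) e xs 1 \<longleftrightarrow> Q xs" if l: "length xs = 4" for xs
  proof
    assume "evals (\<lambda>_. 0) e xs 1"
    from run_complete[OF this] run_complete[OF e(2)[OF l]] obtain s0 s1 where
      "\<forall>s\<ge>s0. run s e xs = Suc 1" "\<forall>s\<ge>s1. run s e xs = Suc (of_bool (Q xs))" by blast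
    then have "Suc 1 = Suc (of_bool (Q xs))" by (metis le_add1 le_add2)
    then show "Q xs" by (cases "Q xs") auto
  qed (use e(2)[OF l] in simp)
  then have "f n = y \<longleftrightarrow> (\<exists>u. \<forall>v. evals (\<lambda>_. 0) e [v, u, n, y] 1)" for n y
    using f P by simp
  then show thesis using that e by blast
qed

text \<open>A guess for \<open>f n\<close> is a code of a pair \<open>(y, u)\<close>, and
  \<open>G n s\<close> is the least code without a failing test found before \<open>s\<close> (or
  \<open>s\<close> itself). Failures are permanent and a correct pair never fails. So the guess
  settles on the least code that never fails, and its first component is \<open>f n\<close>.\<close>

theorem Delta_fun_2_limit:
  assumes "Delta_fun 2 f"
  obtains a guess where "pr_definable 1 (\<lambda>xs. a (hd xs))"
    "pr_definable 2 (\<lambda>xs. guess (hd xs) (hd (tl xs)))"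
    "\<And>n. finite {s. a s = n}"
    "\<And>n M. (\<And>s. a s \<le> n \<Longrightarrow> s \<le> M) \<Longrightarrow> f n = guess n M"
proof -
  from Delta_fun_2_matrix[OF assms] obtain e where e: "has_arity 4 e"
    "\<And>xs. length xs = 4 \<Longrightarrow> \<exists>b. evals (\<lambda>_. 0) e xs (of_bool b)"
    "\<And>n y. f n = y \<longleftrightarrow> (\<exists>u. \<forall>v. evals (\<lambda>_. 0) e [v, u, n, y] 1)" by blast
  define fail where "fail n s w \<longleftrightarrow> (\<exists>v<s. \<exists>t<s.
    run t e [v, snd (prod_decode w), n, fst (prod_decode w)] = 1)" for n s w
  have "pr_definable 5 (\<lambda>ys. run (hd ys) e (tl ys))" using pr_definable_run[OF e(1)] by simp
  have run: "pr_definable k (\<lambda>xs. run (T xs) e [V xs, U xs, N xs, Y xs])"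
    if "pr_definable k T" "pr_definable k V" "pr_definable k U" "pr_definable k N" "pr_definable k Y"
    for k T V U N Y
    using pr.definable_reindex[OF pr_definable_run[OF e(1)], of "[T, V, U, N, Y]" k
        "\<lambda>xs. [T xs, V xs, U xs, N xs, Y xs]"] that by (auto simp: numeral_eq_Suc)
  define G where "G n s = (LEAST w. w = s \<or> \<not> fail n s w)" for n s
  \<comment> \<open>The alternative \<open>n = s\<close> bounds the search. It can add only the
    stage \<open>s = n\<close> to the fibre of \<open>n\<close>.\<close>
  define a where "a s = (LEAST n. n = s \<or> G n s \<noteq> G n (Suc s))" for s
  have G2: "pr_definable 2 (\<lambda>xs. G (hd xs) (hd (tl xs)))"
    unfolding G_def fail_def
    by (rule pr.definable_Least[where N = "\<lambda>xs. hd (tl xs)"];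
        (intro pr.definable_intros run; simp)?) auto
  note G = pr.definable_app2[OF G2]
  have a1: "pr_definable 1 (\<lambda>xs. a (hd xs))"
    unfolding a_def
    by (rule pr.definable_Least[where N = "\<lambda>xs. hd xs"];
        (intro pr.definable_intros G; simp)?) auto
  have fail_mono: "fail n s w \<Longrightarrow> s \<le> t \<Longrightarrow> fail n t w" for n s t w
    unfolding fail_def by (meson less_le_trans)
  have fail_iff: "(\<exists>s. fail n s w) \<longleftrightarrow>
      \<not> (\<forall>v. evals (\<lambda>_. 0) e [v, snd (prod_decode w), n, fst (prod_decode w)] 1)" for n w
  proof
    assume "\<exists>s. fail n s w"
    then obtain v t where vt: "run t e [v, snd (prod_decode w), n, fst (prod_decode w)] = 1"
      (is "run t e ?x = 1") unfolding fail_def by auto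
    then have "evals (\<lambda>_. 0) e ?x 0" using run_sound[OF e(1), of ?x t 0] by simp
    \<comment> \<open>At a late stage \<open>run\<close> would have to return both 1 and 2.\<close>
    from run_complete[OF this] have "\<not> evals (\<lambda>_. 0) e ?x 1"
      using run_complete[of e ?x 1] by (metis One_nat_def nat.inject le_add1 le_add2 zero_neq_one)
    then show "\<not> (\<forall>v. evals (\<lambda>_. 0) e [v, snd (prod_decode w), n, fst (prod_decode w)] 1)" by blast
  next
    assume "\<not> (\<forall>v. evals (\<lambda>_. 0) e [v, snd (prod_decode w), n, fst (prod_decode w)] 1)"
    then obtain v where v: "\<not> evals (\<lambda>_. 0) e [v, snd (prod_decode w), n, fst (prod_decode w)] 1"
      (is "\<not> evals _ e ?x 1") by blast
    obtain b where "evals (\<lambda>_. 0) e ?x (of_bool b)" using e(2)[of ?x] by auto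
    then have "evals (\<lambda>_. 0) e ?x 0" using v by (cases b) auto
    from run_complete[OF this] obtain t where t: "run t e ?x = 1" by auto
    then have "fail n (Suc (v + t)) w" unfolding fail_def by (metis less_Suc_eq_le le_add1 le_add2)
    then show "\<exists>s. fail n s w" ..
  qed
  have lim: "\<exists>w s0. (\<forall>s\<ge>s0. G n s = w) \<and> fst (prod_decode w) = f n" for n
  proof -
    define w where w: "w = (LEAST w. \<forall>s. \<not> fail n s w)"
    obtain u where "\<forall>v. evals (\<lambda>_. 0) e [v, u, n, f n] 1" using e(3)[of n "f n"] by auto
    then have ex: "\<forall>s. \<not> fail n s (prod_encode (f n, u))"
      using fail_iff[of n "prod_encode (f n, u)"] by auto
    then have good: "\<forall>s. \<not> fail n s w" unfolding w by (rule LeastI)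
    have "\<exists>s. fail n s v" if "v < w" for v using that not_less_Least unfolding w by blast
    then obtain S where S: "\<And>v. v < w \<Longrightarrow> fail n (S v) v" by metis
    have "G n s = w" if s: "s \<ge> w + (\<Sum>v<w. S v)" for s
      unfolding G_def
    proof (rule Least_equality)
      show "w = s \<or> \<not> fail n s w" using good by simp
      fix v assume v: "v = s \<or> \<not> fail n s v"
      show "w \<le> v"
      proof (rule ccontr)
        assume "\<not> w \<le> v"
        moreover from this have "s \<ge> S v" using member_le_sum[of v "{..<w}" S] s by auto
        ultimately show False using v s fail_mono[OF S] by auto
      qed
    qed
    moreover have "fst (prod_decode w) = f n"
      using good fail_iff[of n w] e(3)[of n "fst (prod_decode w)"] by auto
    ultimately show ?thesis by blast
  qed
  have fin: "finite {s. a s = n}" for n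
  proof -
    from lim[of n] obtain s0 w where s0: "\<And>s. s \<ge> s0 \<Longrightarrow> G n s = w" by blast
    have "{s. a s = n} \<subseteq> insert n {..<s0}"
    proof
      fix s assume "s \<in> {s. a s = n}"
      moreover have "a s = s \<or> G (a s) s \<noteq> G (a s) (Suc s)" unfolding a_def
        by (rule LeastI[of "\<lambda>n. n = s \<or> G n s \<noteq> G n (Suc s)" s]) simp
      ultimately show "s \<in> insert n {..<s0}" using s0[of s] s0[of "Suc s"] by force
    qed
    then show ?thesis using finite_subset by blast
  qed
  have val: "f n = fst (prod_decode (G n (Suc M)))" if M: "\<And>s. a s \<le> n \<Longrightarrow> s \<le> M" for n M
  proof -
    \<comment> \<open>\<open>a s\<close> is the least argument with a change at stage
      \<open>s\<close>, so a change at \<open>n\<close> forces \<open>a s <= n\<close>. A change at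
      stage \<open>M\<close> itself remains possible, hence the value is read at
      \<open>Suc M\<close>.\<close>
    have step: "G n s = G n (Suc s)" if "s > M" for s
    proof (rule ccontr)
      assume "G n s \<noteq> G n (Suc s)"
      then have "a s \<le> n" unfolding a_def by (intro Least_le) simp
      then show False using M that by fastforce
    qed
    have eq: "G n (Suc M + k) = G n (Suc M)" for k
    proof (induction k)
      case (Suc k)
      then show ?case using step[of "Suc M + k"] by simp
    qed simp
    from lim[of n] obtain s0 w
      where s0: "\<forall>s\<ge>s0. G n s = w" "fst (prod_decode w) = f n" by blast
    have "G n (Suc M + s0) = w \<and> fst (prod_decode w) = f n" using s0 by simp
    then show ?thesis using eq[of s0] by simp
  qed
  have "pr_definable 2 (\<lambda>xs. fst (prod_decode (G (hd xs) (Suc (hd (tl xs))))))"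
    by (intro pr.definable_intros G) auto
  then show thesis
    using that[of a "\<lambda>n M. fst (prod_decode (G n (Suc M)))"] a1 fin val by blast
qed


section \<open>Orbits of injection structures\<close>

definition conn :: "structure_1 \<Rightarrow> nat \<Rightarrow> nat \<Rightarrow> bool" where
  "conn A x y \<longleftrightarrow> (\<exists>i j. (A ^^ i) x = (A ^^ j) y)"

definition periodic :: "structure_1 \<Rightarrow> nat \<Rightarrow> bool" where
  "periodic A x \<longleftrightarrow> (\<exists>p>0. (A ^^ p) x = x)"

lemma connI: "(A ^^ i) x = (A ^^ j) y \<Longrightarrow> conn A x y"
  unfolding conn_def by blast

lemma conn_refl: "conn A x x"
  by (rule connI[of 0 _ _ 0]) simp

lemma conn_sym: "conn A x y \<Longrightarrow> conn A y x"
  unfolding conn_def by metis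

lemma conn_trans:
  assumes "conn A x y" "conn A y z"
  shows "conn A x z"
proof -
  from assms obtain i j k l where 1: "(A ^^ i) x = (A ^^ j) y" and 2: "(A ^^ k) y = (A ^^ l) z"
    unfolding conn_def by blast
  have "(A ^^ (k + i)) x = (A ^^ (k + j)) y" using 1 by (simp add: funpow_add)
  also have "\<dots> = (A ^^ (j + k)) y" by (simp add: add.commute)
  also have "\<dots> = (A ^^ (j + l)) z" using 2 by (simp add: funpow_add)
  finally show ?thesis by (rule connI)
qed

lemma conn_step: "conn A (A x) x"
  by (rule connI[of 0 _ _ 1]) simp

lemma conn_funpow: "conn A ((A ^^ k) x) x"
  by (rule connI[of 0 _ _ k]) simp

lemma funpow_cancel: "inj (A :: structure_1) \<Longrightarrow> (A ^^ i) x = (A ^^ i) y \<longleftrightarrow> x = y"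
  using inj_eq[OF inj_fn[of A i]] by simp

lemma funpow_eqD:
  fixes A :: structure_1
  assumes "inj A" "(A ^^ i) x = (A ^^ j) y" "i \<le> j"
  shows "x = (A ^^ (j - i)) y"
  using assms funpow_cancel[OF assms(1), of i x "(A ^^ (j - i)) y"]
  by (simp flip: funpow_add comp_apply[of "A ^^ i"])

lemma periodic_if_funpow_eq:
  fixes A :: structure_1
  assumes "inj A" "(A ^^ i) x = (A ^^ j) x" "i \<noteq> j"
  shows "periodic A x"
proof (cases "i < j")
  case True
  then show ?thesis using funpow_eqD[OF assms(1,2)] unfolding periodic_def
    by (intro exI[of _ "j - i"]) auto
next
  case False
  then show ?thesis using funpow_eqD[OF assms(1) assms(2)[symmetric]] assms(3) unfolding periodic_def
    by (intro exI[of _ "i - j"]) auto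
qed

lemma funpow_mult_period: "(A ^^ p) x = x \<Longrightarrow> (A ^^ (n * p)) x = x"
  by (induction n) (auto simp: funpow_add)

lemma funpow_mod_period: "(A ^^ p) x = x \<Longrightarrow> (A ^^ i) x = (A ^^ (i mod p)) x"
  by (simp add: funpow_mod_eq)

lemma periodic_conn:
  assumes A: "inj A" and "conn A x y" "periodic A x"
  shows "periodic A y"
proof -
  from assms(2,3) obtain i j p where ij: "(A ^^ i) x = (A ^^ j) y" and p: "p > 0" "(A ^^ p) x = x"
    unfolding conn_def periodic_def by blast
  have "(A ^^ (j + p)) y = (A ^^ (p + i)) x" using ij by (simp add: funpow_add add.commute[of j])
  also have "\<dots> = (A ^^ (i + p)) x" by (simp add: add.commute)
  also have "\<dots> = (A ^^ j) y" using p ij by (simp add: funpow_add)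
  finally show ?thesis using p by (intro periodic_if_funpow_eq[OF A, of "j + p" y j]) auto
qed

lemma periodic_in_range:
  assumes "periodic A x"
  shows "x \<in> range (A ^^ k)"
proof -
  from assms obtain p where p: "p > 0" "(A ^^ p) x = x" unfolding periodic_def by blast
  have "x = (A ^^ (k * p)) x" using funpow_mult_period[OF p(2)] by simp
  also have "\<dots> = (A ^^ k) ((A ^^ (k * p - k)) x)"
    using p(1) by (simp flip: funpow_add comp_apply[of "A ^^ k"])
  finally show ?thesis by blast
qed

text \<open>An isomorphism is determined by pairs of points that meet all orbits on both sides.\<close>

locale orbit_matching =
  fixes A B :: structure_1 and M :: "(nat \<times> nat) set"
  assumes inj_A: "inj A" and inj_B: "inj B"
    and match: "(v, v') \<in> M \<Longrightarrow> (w, w') \<in> M \<Longrightarrow> (A ^^ i) v = (A ^^ j) w \<longleftrightarrow> (B ^^ i) v' = (B ^^ j) w'"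
    and depth: "(v, v') \<in> M \<Longrightarrow> v \<in> range (A ^^ k) \<longleftrightarrow> v' \<in> range (B ^^ k)"
    and cover_A: "\<exists>v v'. (v, v') \<in> M \<and> conn A x v"
    and cover_B: "\<exists>v v'. (v, v') \<in> M \<and> conn B y v'"
begin

text \<open>The exponents \<open>i\<close> and \<open>j\<close> express the offset
  \<open>j - i\<close> from a matched point, which may be negative; \<open>x\<close> and
  \<open>y\<close> have the same offset from the two points of a matched pair.\<close>

definition glue :: "nat \<Rightarrow> nat \<Rightarrow> bool" where
  "glue x y \<longleftrightarrow> (\<exists>v v' i j. (v, v') \<in> M \<and> (A ^^ i) x = (A ^^ j) v \<and> (B ^^ i) y = (B ^^ j) v')"

lemma glue_unique:
  assumes "glue x y" "glue x z"
  shows "y = z"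
proof -
  from assms obtain v v' i j w w' k l where
    1: "(v, v') \<in> M" "(A ^^ i) x = (A ^^ j) v" "(B ^^ i) y = (B ^^ j) v'" and
    2: "(w, w') \<in> M" "(A ^^ k) x = (A ^^ l) w" "(B ^^ k) z = (B ^^ l) w'"
    unfolding glue_def by blast
  have "(A ^^ (k + j)) v = (A ^^ (k + i)) x" using 1 by (simp add: funpow_add)
  also have "\<dots> = (A ^^ (i + k)) x" by (simp add: add.commute)
  also have "\<dots> = (A ^^ (i + l)) w" using 2 by (simp add: funpow_add)
  finally have "(B ^^ (k + j)) v' = (B ^^ (i + l)) w'" using match[OF 1(1) 2(1)] by blast
  moreover have "(B ^^ (k + i)) y = (B ^^ (k + j)) v'" using 1 by (simp add: funpow_add)
  moreover have "(B ^^ (i + k)) z = (B ^^ (i + l)) w'" using 2 by (simp add: funpow_add)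
  ultimately have "(B ^^ (k + i)) y = (B ^^ (k + i)) z" by (simp add: add.commute)
  then show ?thesis using funpow_cancel[OF inj_B] by blast
qed

lemma glue_exists: "\<exists>y. glue x y"
proof -
  obtain v v' i j where M: "(v, v') \<in> M" and ij: "(A ^^ i) x = (A ^^ j) v"
    using cover_A[of x] unfolding conn_def by blast
  show ?thesis
  proof (cases "i \<le> j")
    case True
    then have "(B ^^ i) ((B ^^ (j - i)) v') = (B ^^ j) v'" by (simp flip: funpow_add comp_apply[of "B ^^ i"])
    then show ?thesis using M ij unfolding glue_def by blast
  next
    case False
    \<comment> \<open>Here \<open>v\<close> lies ahead of \<open>x\<close>, so the partner of
      \<open>x\<close> is found by going back from \<open>v'\<close>; \<open>depth\<close> supplies
      the preimage.\<close>
    then have "v = (A ^^ (i - j)) x" using funpow_eqD[OF inj_A ij[symmetric]] by simp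
    then have "v' \<in> range (B ^^ (i - j))" using depth[OF M] by blast
    then obtain y where "v' = (B ^^ (i - j)) y" by blast
    then have "(B ^^ i) y = (B ^^ j) v'" using False by (simp flip: funpow_add comp_apply[of "B ^^ j"])
    then show ?thesis using M ij unfolding glue_def by blast
  qed
qed

lemma glue_step: "glue x y \<Longrightarrow> glue (A x) (B y)"
  unfolding glue_def by (metis (no_types) funpow_swap1 funpow.simps(2) comp_apply)

lemma converse: "orbit_matching B A (M\<inverse>)"
proof
  show "\<exists>v v'. (v, v') \<in> M\<inverse> \<and> conn B x v" for x using cover_B[of x] by auto
  show "\<exists>v v'. (v, v') \<in> M\<inverse> \<and> conn A x v'" for x using cover_A[of x] by auto
qed (use inj_A inj_B match depth in auto)

text \<open>The equivalence with \<open>glue\<close> is kept in the conclusion because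
  \<open>glue\<close> is an existential formula and gives the complexity of the isomorphism.
  Surjectivity and injectivity come from the locale with the two sides exchanged.\<close>

theorem glue_isomorphism: "\<exists>h. isomorphism A B h \<and> (\<forall>x y. h x = y \<longleftrightarrow> glue x y)"
proof -
  interpret conv: orbit_matching B A "M\<inverse>" by (rule converse)
  have conv: "conv.glue y x \<longleftrightarrow> glue x y" for x y
    unfolding glue_def conv.glue_def by auto
  define h where "h x = (THE y. glue x y)" for x
  have h: "h x = y \<longleftrightarrow> glue x y" for x y
    unfolding h_def using glue_exists[of x] glue_unique[of x] by (metis the_equality)
  have "inj h" by (rule injI) (metis h conv conv.glue_unique)
  moreover have "surj h" by (metis surjI[of h "\<lambda>y. SOME x. glue x y"] h conv conv.glue_exists someI)
  moreover have "h (A x) = B (h x)" for x using glue_step h by metis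
  ultimately show ?thesis using h unfolding isomorphism_def bij_def by blast
qed

end

text \<open>For representatives of infinite orbits the matching condition is automatic: distinct
  ones never meet under iteration, and the iterates of a single one are pairwise different. So
  either equation holds iff \<open>v = w\<close> and \<open>i = j\<close>. Only the cycles need an
  explicit condition.\<close>

lemma orbit_matchingI:
  assumes A: "inj A" and B: "inj B"
    and C: "\<And>v v'. (v, v') \<in> C \<Longrightarrow> periodic A v \<and> periodic B v'"
    and C_match: "\<And>v v' w w' i j. (v, v') \<in> C \<Longrightarrow> (w, w') \<in> C \<Longrightarrow>
      (A ^^ i) v = (A ^^ j) w \<longleftrightarrow> (B ^^ i) v' = (B ^^ j) w'"
    and C_A: "\<And>x. periodic A x \<Longrightarrow> \<exists>v v'. (v, v') \<in> C \<and> conn A x v"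
    and C_B: "\<And>y. periodic B y \<Longrightarrow> \<exists>v v'. (v, v') \<in> C \<and> conn B y v'"
    and V: "\<And>v. v \<in> V \<Longrightarrow> \<not> periodic A v" "\<And>v w. v \<in> V \<Longrightarrow> w \<in> V \<Longrightarrow> conn A v w \<Longrightarrow> v = w"
      "\<And>x. \<not> periodic A x \<Longrightarrow> \<exists>v\<in>V. conn A x v"
    and W: "\<And>v. v \<in> k ` V \<Longrightarrow> \<not> periodic B v"
      "\<And>v w. v \<in> k ` V \<Longrightarrow> w \<in> k ` V \<Longrightarrow> conn B v w \<Longrightarrow> v = w"
      "\<And>y. \<not> periodic B y \<Longrightarrow> \<exists>v\<in>k ` V. conn B y v"
    and k: "inj_on k V"
    and V_depth: "\<And>v n. v \<in> V \<Longrightarrow> v \<in> range (A ^^ n) \<longleftrightarrow> k v \<in> range (B ^^ n)"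
  shows "orbit_matching A B (C \<union> (\<lambda>v. (v, k v)) ` V)"
proof
  show "inj A" "inj B" by fact+
  show "\<exists>v v'. (v, v') \<in> C \<union> (\<lambda>v. (v, k v)) ` V \<and> conn A x v" for x
    using C_A[of x] V(3)[of x] by blast
  show "\<exists>v v'. (v, v') \<in> C \<union> (\<lambda>v. (v, k v)) ` V \<and> conn B y v'" for y
    using C_B[of y] W(3)[of y] by blast
  show "v \<in> range (A ^^ n) \<longleftrightarrow> v' \<in> range (B ^^ n)" if "(v, v') \<in> C \<union> (\<lambda>v. (v, k v)) ` V" for v v' n
    using that
  proof
    assume "(v, v') \<in> C"
    then show ?thesis using C periodic_in_range by meson
  next
    assume "(v, v') \<in> (\<lambda>v. (v, k v)) ` V"
    then show ?thesis using V_depth by auto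
  qed
  have mixed: "(A ^^ i) v \<noteq> (A ^^ j) w \<and> (B ^^ i) v' \<noteq> (B ^^ j) (k w)" if "(v, v') \<in> C" "w \<in> V"
    for v v' w i j
    using that C[of v v'] V(1)[of w] W(1)[of "k w"] periodic_conn[OF A, of v w] periodic_conn[OF B, of v' "k w"]
      connI by blast
  fix v v' w w' i j
  assume "(v, v') \<in> C \<union> (\<lambda>v. (v, k v)) ` V" "(w, w') \<in> C \<union> (\<lambda>v. (v, k v)) ` V"
  then consider "(v, v') \<in> C" "(w, w') \<in> C" | "(v, v') \<in> C" "w \<in> V" "w' = k w"
    | "(w, w') \<in> C" "v \<in> V" "v' = k v" | "v \<in> V" "v' = k v" "w \<in> V" "w' = k w" by blast
  then show "(A ^^ i) v = (A ^^ j) w \<longleftrightarrow> (B ^^ i) v' = (B ^^ j) w'"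
  proof cases
    case 1
    then show ?thesis by (rule C_match)
  next
    case 2
    then show ?thesis using mixed by simp
  next
    case 3
    then show ?thesis using mixed[of w w' v j i] by (simp add: eq_commute)
  next
    case 4
    show ?thesis
    proof (cases "v = w")
      case True
      then show ?thesis using 4 V(1)[of v] W(1)[of "k v"] periodic_if_funpow_eq[OF A, of i v j]
          periodic_if_funpow_eq[OF B, of i "k v" j] by (cases "i = j") auto
    next
      case False
      then have "\<not> conn A v w" "\<not> conn B v' w'"
        using 4 V(2)[of v w] W(2)[of v' w'] inj_onD[OF k, of v w] by auto
      then show ?thesis using connI by blast
    qed
  qed
qed

section \<open>Omega-chains, two-sided chains and their representatives\<close>

definition roots :: "structure_1 \<Rightarrow> nat set" where
  "roots A = - range A"

definition twosided :: "structure_1 \<Rightarrow> nat set" where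
  "twosided A = {x. \<not> periodic A x \<and> (\<forall>k. x \<in> range (A ^^ k))}"

text \<open>A two-sided chain has no distinguished point, so its least number is chosen.\<close>

definition twosided_reps :: "structure_1 \<Rightarrow> nat set" where
  "twosided_reps A = {x \<in> twosided A. \<forall>y. conn A x y \<longrightarrow> x \<le> y}"

lemma root_in_range_funpow: "x \<in> roots A \<Longrightarrow> x \<in> range (A ^^ k) \<longleftrightarrow> k = 0"
  unfolding roots_def by (cases k) auto

lemma root_not_periodic: "x \<in> roots A \<Longrightarrow> \<not> periodic A x"
  using periodic_in_range[of A x 1] unfolding roots_def by auto

text \<open>Taking preimages from \<open>x\<close> must stop before \<open>k\<close> steps, and the
  point where it stops is a root.\<close>

lemma ex_root:
  assumes "x \<notin> range (A ^^ k)"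
  shows "\<exists>r\<in>roots A. conn A x r"
  using assms
proof (induction k arbitrary: x)
  case (Suc k)
  show ?case
  proof (cases "x \<in> range A")
    case True
    then obtain y where y: "x = A y" by blast
    then have "y \<notin> range (A ^^ k)" using Suc.prems by auto
    then show ?thesis using Suc.IH y conn_step conn_trans by blast
  next
    case False
    then show ?thesis unfolding roots_def using conn_refl by blast
  qed
qed simp

lemma twosided_conn:
  assumes A: "inj A" and "x \<in> twosided A" and xy: "conn A x y"
  shows "y \<in> twosided A"
proof -
  have "y \<in> range (A ^^ k)" for k
  proof -
    from xy obtain i j where ij: "(A ^^ i) x = (A ^^ j) y" unfolding conn_def by blast
    \<comment> \<open>Going back \<open>j + k\<close> steps from \<open>x\<close> leaves, after
      \<open>j\<close> steps are cancelled, \<open>k\<close> steps behind \<open>y\<close>.\<close>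
    obtain z where z: "x = (A ^^ (j + k)) z" using assms(2) unfolding twosided_def by blast
    have "(A ^^ j) y = (A ^^ (i + (j + k))) z" using ij z by (simp add: funpow_add)
    also have "i + (j + k) = j + (k + i)" by simp
    finally have "(A ^^ j) y = (A ^^ j) ((A ^^ k) ((A ^^ i) z))" by (simp only: funpow_add comp_apply)
    then have "y = (A ^^ k) ((A ^^ i) z)" using funpow_cancel[OF A] by blast
    then show ?thesis by blast
  qed
  then show ?thesis using assms(2) periodic_conn[OF A conn_sym[OF xy]] unfolding twosided_def by blast
qed

lemma roots_conn_eq:
  assumes A: "inj A" and r: "r \<in> roots A" and s: "s \<in> roots A" and "conn A r s"
  shows "r = s"
proof -
  \<comment> \<open>Cancelling makes \<open>r\<close> the iterate of \<open>s\<close> by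
    \<open>j - i\<close> steps, and a root is no proper iterate.\<close>
  have *: "j - i = 0" if "(A ^^ i) r = (A ^^ j) s" "i \<le> j" "r \<in> roots A" for i j r s
    using funpow_eqD[OF A that(1,2)] that(3) root_in_range_funpow[of r A "j - i"] by blast
  from assms(4) obtain i j where ij: "(A ^^ i) r = (A ^^ j) s" unfolding conn_def by blast
  then have "i = j" using *[OF ij _ r] *[OF ij[symmetric] _ s] by (metis diff_is_0_eq le_antisym nle_le)
  then show ?thesis using ij funpow_cancel[OF A] by blast
qed

lemma infinite_orbit_reps:
  assumes A: "inj A"
  defines "V \<equiv> roots A \<union> twosided_reps A"
  shows "v \<in> V \<Longrightarrow> \<not> periodic A v"
    and "v \<in> V \<Longrightarrow> w \<in> V \<Longrightarrow> conn A v w \<Longrightarrow> v = w"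
    and "\<not> periodic A x \<Longrightarrow> \<exists>v\<in>V. conn A x v"
proof -
  show "v \<in> V \<Longrightarrow> \<not> periodic A v"
    unfolding V_def twosided_reps_def twosided_def using root_not_periodic by auto
  have disj: "r \<notin> roots A" if "r \<in> twosided A" for r
    using that root_in_range_funpow[of r A 1] unfolding twosided_def by fastforce
  show "v = w" if "v \<in> V" "w \<in> V" "conn A v w"
  proof (cases "v \<in> twosided A")
    case True
    then have "w \<in> twosided A" using twosided_conn[OF A] that by blast
    then show ?thesis using True that disj conn_sym[OF that(3)] unfolding V_def twosided_reps_def
      by (auto intro: le_antisym)
  next
    case False
    then have "w \<notin> twosided A" using twosided_conn[OF A] that conn_sym by blast
    then show ?thesis using False that roots_conn_eq[OF A] unfolding V_def twosided_reps_def by auto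
  qed
  show "\<exists>v\<in>V. conn A x v" if "\<not> periodic A x"
  proof (cases "x \<in> twosided A")
    case True
    define v where "v = (LEAST v. conn A x v)"
    have v: "conn A x v" unfolding v_def using conn_refl by (rule LeastI)
    have "v \<le> y" if "conn A v y" for y
      unfolding v_def by (rule Least_le) (use v that conn_trans in blast)
    then have "v \<in> twosided_reps A" using twosided_conn[OF A True v] unfolding twosided_reps_def by blast
    then show ?thesis using v unfolding V_def by blast
  next
    case False
    then show ?thesis using ex_root that unfolding twosided_def V_def by blast
  qed
qed

section \<open>Isomorphisms preserve orbits, periodicity and depth\<close>

lemma isomorphism_funpow: "isomorphism A B h \<Longrightarrow> h ((A ^^ k) x) = (B ^^ k) (h x)"
  by (induction k) (auto simp: isomorphism_def)

lemma isomorphism_inv: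
  assumes "isomorphism A B h"
  shows "isomorphism B A (inv h)"
proof -
  have h: "bij h" "\<And>x. h (A x) = B (h x)" using assms unfolding isomorphism_def by auto
  then have "inv h (B y) = A (inv h y)" for y
    by (metis bij_inv_eq_iff)
  then show ?thesis using h(1) unfolding isomorphism_def by (simp add: bij_imp_bij_inv)
qed

lemma isomorphism_comp:
  "isomorphism A B h \<Longrightarrow> isomorphism B C g \<Longrightarrow> isomorphism A C (g \<circ> h)"
  unfolding isomorphism_def by (auto intro: bij_comp)

lemma isomorphism_inj: "isomorphism A B h \<Longrightarrow> inj h"
  unfolding isomorphism_def by (simp add: bij_is_inj)

lemma isomorphism_conn: "isomorphism A B h \<Longrightarrow> conn B (h x) (h y) \<longleftrightarrow> conn A x y"
  unfolding conn_def using isomorphism_inj[of A B h]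
  by (simp flip: isomorphism_funpow add: inj_eq)

lemma isomorphism_periodic: "isomorphism A B h \<Longrightarrow> periodic B (h x) \<longleftrightarrow> periodic A x"
  unfolding periodic_def using isomorphism_inj[of A B h]
  by (simp flip: isomorphism_funpow add: inj_eq)

lemma isomorphism_range:
  assumes h: "isomorphism A B h"
  shows "h x \<in> range (B ^^ k) \<longleftrightarrow> x \<in> range (A ^^ k)"
proof -
  have "surj h" using h unfolding isomorphism_def bij_def by blast
  then have "range (B ^^ k) = (B ^^ k) ` range h" by simp
  also have "\<dots> = h ` range (A ^^ k)"
    by (simp add: image_image isomorphism_funpow[OF h])
  finally have "range (B ^^ k) = h ` range (A ^^ k)" .
  then show ?thesis using isomorphism_inj[OF h] by (simp add: inj_image_mem_iff)
qed

lemma isomorphism_inj_structure: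
  assumes h: "isomorphism A B h" and A: "inj A"
  shows "inj B"
proof (rule injI)
  fix x y assume "B x = B y"
  moreover obtain a b where "x = h a" "y = h b" using h unfolding isomorphism_def by (metis bij_pointE)
  ultimately have "h (A a) = h (A b)" using h unfolding isomorphism_def by simp
  then show "x = y" using A isomorphism_inj[OF h] \<open>x = h a\<close> \<open>y = h b\<close> by (auto dest: injD)
qed


section \<open>Injection structures with finitely many infinite orbits\<close>

text \<open>All conditions are bounded by \<open>p\<close>, so leaders can be recognized by
  computation, whereas periodicity of a point is an unbounded existential condition.\<close>

definition cycle_leader :: "structure_1 \<Rightarrow> nat \<Rightarrow> nat \<Rightarrow> bool" where
  "cycle_leader A p x \<longleftrightarrow> p > 0 \<and> (A ^^ p) x = x \<and>
     (\<forall>q<p. (q > 0 \<longrightarrow> (A ^^ q) x \<noteq> x) \<and> x \<le> (A ^^ q) x)"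

text \<open>For a leader \<open>x\<close> this is the index of its cycle in the list of all
  \<open>p\<close>-cycles, ordered by their least points.\<close>

definition leader_rank :: "structure_1 \<Rightarrow> nat \<Rightarrow> nat \<Rightarrow> nat" where
  "leader_rank A p x = card {u. u < x \<and> cycle_leader A p u}"

lemma ex_cycle_leader:
  assumes A: "inj A" and x: "periodic A x"
  shows "\<exists>p v. cycle_leader A p v \<and> conn A x v"
proof -
  define v where "v = (LEAST v. conn A x v)"
  have v: "conn A x v" unfolding v_def using conn_refl by (rule LeastI)
  have v_le: "v \<le> y" if "conn A v y" for y
    unfolding v_def by (rule Least_le) (use v that conn_trans in blast)
  have "\<exists>p. p > 0 \<and> (A ^^ p) v = v"
    using periodic_conn[OF A v x] unfolding periodic_def .
  then obtain p where p: "p > 0" "(A ^^ p) v = v" and min: "\<And>q. q < p \<Longrightarrow> \<not> (q > 0 \<and> (A ^^ q) v = v)"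
    using exists_least_iff[of "\<lambda>p. p > 0 \<and> (A ^^ p) v = v"] by blast
  have "v \<le> (A ^^ q) v" for q using v_le conn_sym[OF conn_funpow] by blast
  then show ?thesis using p min v unfolding cycle_leader_def by blast
qed

lemma cycle_leader_conn_le:
  assumes x: "cycle_leader A p x" and y: "cycle_leader A q y" and "conn A x y"
  shows "x \<le> y"
proof -
  obtain i j where ij: "(A ^^ i) x = (A ^^ j) y" using assms(3) unfolding conn_def by blast
  have q: "q > 0" "(A ^^ q) y = y" and p: "p > 0" "(A ^^ p) x = x"
    using x y unfolding cycle_leader_def by auto
  \<comment> \<open>Walking \<open>j * q\<close> steps around the cycle returns to \<open>y\<close>,
    and after \<open>j\<close> of them the walk is on the forward orbit of \<open>x\<close>.\<close>
  have "y = (A ^^ (j * q)) y" using funpow_mult_period[OF q(2)] by simp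
  also have "j * q = (j * q - j) + j" using q(1) by simp
  also have "(A ^^ \<dots>) y = (A ^^ (j * q - j)) ((A ^^ i) x)" unfolding funpow_add ij by simp
  also have "\<dots> = (A ^^ (j * q - j + i)) x" by (simp add: funpow_add)
  also have "\<dots> = (A ^^ ((j * q - j + i) mod p)) x" by (rule funpow_mod_period[OF p(2)])
  finally have "y = (A ^^ ((j * q - j + i) mod p)) x" .
  moreover have "(j * q - j + i) mod p < p" using p(1) by simp
  ultimately show ?thesis using x unfolding cycle_leader_def by metis
qed

lemma cycle_leader_conn_eq:
  assumes x: "cycle_leader A p x" and y: "cycle_leader A q y" and "conn A x y"
  shows "x = y \<and> p = q"
proof -
  have "x = y" using cycle_leader_conn_le assms conn_sym by (meson le_antisym)
  moreover have "p = q"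
    using x y unfolding cycle_leader_def \<open>x = y\<close> by (metis linorder_neqE_nat)
  ultimately show ?thesis ..
qed

lemma cycle_leader_funpow_eq:
  assumes A: "inj A" and x: "cycle_leader A p x"
  shows "(A ^^ i) x = (A ^^ j) x \<longleftrightarrow> i mod p = j mod p"
proof
  have p: "p > 0" "(A ^^ p) x = x" using x unfolding cycle_leader_def by auto
  have *: "\<not> a < b" if "(A ^^ a) x = (A ^^ b) x" "b < p" for a b
  proof
    assume "a < b"
    then have "x = (A ^^ (b - a)) x" using funpow_eqD[OF A that(1)] by simp
    then show False using x \<open>a < b\<close> that(2) unfolding cycle_leader_def
      by (metis less_imp_diff_less zero_less_diff)
  qed
  assume "(A ^^ i) x = (A ^^ j) x"
  then have "(A ^^ (i mod p)) x = (A ^^ (j mod p)) x"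
    using funpow_mod_period[OF p(2)] by metis
  then show "i mod p = j mod p" using *[of "i mod p" "j mod p"] *[of "j mod p" "i mod p"] p(1)
    by (metis linorder_neqE_nat mod_less_divisor)
next
  assume "i mod p = j mod p"
  then show "(A ^^ i) x = (A ^^ j) x"
    using x funpow_mod_period[where A = A and p = p and x = x] unfolding cycle_leader_def by metis
qed

lemma ex_element_of_rank:
  fixes S :: "nat set"
  assumes "finite S \<Longrightarrow> m < card S"
  shows "\<exists>x\<in>S. card {u. u < x \<and> u \<in> S} = m"
  using assms
proof (induction m)
  case 0
  then obtain x where "x \<in> S" by (metis card.empty ex_in_conv finite.emptyI less_nat_zero_code)
  then have "(LEAST x. x \<in> S) \<in> S" by (rule LeastI)
  moreover have "{u. u < (LEAST x. x \<in> S) \<and> u \<in> S} = {}" using not_less_Least by blast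
  ultimately show ?case by (metis card.empty)
next
  case (Suc m)
  then obtain x where x: "x \<in> S" "card {u. u < x \<and> u \<in> S} = m" by fastforce
  let ?L = "insert x {u. u < x \<and> u \<in> S}"
  have L: "card ?L = Suc m" using x by simp
  have "\<exists>y\<in>S. x < y"
  proof (rule ccontr)
    assume "\<not> (\<exists>y\<in>S. x < y)"
    then have "S = ?L" using x by (auto simp: not_less order_le_less)
    then show False using Suc.prems L by (metis finite.insertI finite_Collect_conjI finite_Collect_less_nat less_irrefl)
  qed
  then obtain y where y: "y \<in> S \<and> x < y" "\<And>z. z < y \<Longrightarrow> \<not> (z \<in> S \<and> x < z)"
    using exists_least_iff[of "\<lambda>y. y \<in> S \<and> x < y"] by blast
  then have "{u. u < y \<and> u \<in> S} = ?L" using x by (auto simp: not_less) (metis le_neq_implies_less)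
  then show ?case using y L by metis
qed

lemma leader_rank_eq_inj:
  assumes "cycle_leader A p x" "cycle_leader A p y" "leader_rank A p x = leader_rank A p y"
  shows "x = y"
proof (rule ccontr)
  have *: "leader_rank A p x < leader_rank A p y" if "x < y" "cycle_leader A p x" for x y
    unfolding leader_rank_def by (rule psubset_card_mono) (use that in auto)
  assume "x \<noteq> y"
  then show False using * assms by (metis less_irrefl linorder_neqE_nat)
qed

text \<open>An isomorphism carries \<open>p\<close>-cycles to \<open>p\<close>-cycles, so
  \<open>A\<close> has at least as many of them as \<open>B\<close>, and a rank that occurs in
  \<open>B\<close> occurs in \<open>A\<close>. Least points are not preserved, so the image of a
  leader is replaced by the leader of its cycle.\<close>

lemma ex_leader_of_rank:
  assumes A: "inj A" and g: "isomorphism B A g" and y: "cycle_leader B p y"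
  shows "\<exists>x. cycle_leader A p x \<and> leader_rank A p x = leader_rank B p y"
proof -
  let ?S = "\<lambda>A. {x. cycle_leader A p x}"
  have B: "inj B" using isomorphism_inj_structure[OF isomorphism_inv[OF g] A] .
  have ex: "\<exists>x. cycle_leader A p x \<and> conn A (g y) x" if y: "cycle_leader B p y" for y
  proof -
    have "periodic B y" using y unfolding cycle_leader_def periodic_def by blast
    then obtain q x where x: "cycle_leader A q x" "conn A (g y) x"
      using ex_cycle_leader[OF A] isomorphism_periodic[OF g] by blast
    have per: "(A ^^ k) (g y) = g y \<longleftrightarrow> (B ^^ k) y = y" for k
      using isomorphism_inj[OF g] by (simp flip: isomorphism_funpow[OF g] add: inj_eq)
    have conn_per: "(A ^^ k) v = v" if vw: "conn A v w" and "(A ^^ k) w = w" for k v w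
    proof -
      obtain i j where ij: "(A ^^ i) v = (A ^^ j) w" using vw unfolding conn_def by blast
      have "(A ^^ i) ((A ^^ k) v) = (A ^^ k) ((A ^^ i) v)" by (simp flip: funpow_add comp_apply[of "A ^^ _"] add: add.commute)
      also have "\<dots> = (A ^^ j) ((A ^^ k) w)" unfolding ij by (simp flip: funpow_add comp_apply[of "A ^^ _"] add: add.commute)
      finally show ?thesis using that(2) ij funpow_cancel[OF A] by metis
    qed
    have per: "(A ^^ k) x = x \<longleftrightarrow> (B ^^ k) y = y" for k
      using per conn_per x(2) conn_sym by blast
    have "p = q" using x(1) y unfolding cycle_leader_def per by (metis linorder_neqE_nat)
    then show ?thesis using x by blast
  qed
  then obtain \<phi> where \<phi>: "\<And>y. cycle_leader B p y \<Longrightarrow> cycle_leader A p (\<phi> y) \<and> conn A (g y) (\<phi> y)"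
    by metis
  have "inj_on \<phi> (?S B)"
  proof (rule inj_onI)
    fix y z assume yz: "y \<in> ?S B" "z \<in> ?S B" "\<phi> y = \<phi> z"
    then have "conn A (g y) (g z)" using \<phi>[of y] \<phi>[of z] conn_sym conn_trans by (metis mem_Collect_eq)
    then have "conn B y z" using isomorphism_conn[OF g] by blast
    then show "y = z" using cycle_leader_conn_eq yz by blast
  qed
  moreover have "\<phi> ` ?S B \<subseteq> ?S A" using \<phi> by blast
  ultimately have le: "finite (?S B) \<and> card (?S B) \<le> card (?S A)" if "finite (?S A)"
    using that by (metis card_inj_on_le inj_on_finite)
  have "leader_rank B p y < card (?S B)" if "finite (?S B)"
    unfolding leader_rank_def by (rule psubset_card_mono) (use that y in auto)
  then have "leader_rank B p y < card (?S A)" if "finite (?S A)" using le[OF that] by linarith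
  from ex_element_of_rank[OF this] show ?thesis unfolding leader_rank_def by simp
qed

context scheme_class
begin

lemma decidable_cycle_leader:
  assumes A: "definable 1 (\<lambda>xs. A (hd xs))" and "definable k P" "definable k F"
  shows "decidable k (\<lambda>xs. cycle_leader A (P xs) (F xs))"
proof (rule definable_app2[where f = "\<lambda>p x. of_bool (cycle_leader A p x)"])
  show "decidable 2 (\<lambda>xs. cycle_leader A (hd xs) (hd (tl xs)))"
    unfolding cycle_leader_def by (intro definable_intros definable_funpow[OF A]; simp)
qed fact+

lemma definable_leader_rank:
  assumes A: "definable 1 (\<lambda>xs. A (hd xs))" and "definable k P" "definable k F"
  shows "definable k (\<lambda>xs. leader_rank A (P xs) (F xs))"
proof (rule definable_app2[where f = "leader_rank A"])
  show "definable 2 (\<lambda>xs. leader_rank A (hd xs) (hd (tl xs)))"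
    unfolding leader_rank_def
    by (intro definable_intros definable_count decidable_cycle_leader[OF A]; simp)
qed fact+

end

theorem relatively_Delta_1_categorical:
  assumes A: "inj A" and pr: "primitive_recursive A" and fin: "finite (roots A \<union> twosided_reps A)"
  shows "relatively_Delta_categorical 1 A"
  unfolding relatively_Delta_categorical_def
proof (intro allI impI)
  fix B assume "isomorphic_1 B A"
  then obtain g where g: "isomorphism B A g" unfolding isomorphic_1_def by blast
  define h where "h = inv g"
  have h: "isomorphism A B h" unfolding h_def by (rule isomorphism_inv[OF g])
  have B: "inj B" by (rule isomorphism_inj_structure[OF h A])
  define V where "V = roots A \<union> twosided_reps A"
  note V = infinite_orbit_reps[OF A, folded V_def]
  define C where "C = {(x, y). \<exists>p. cycle_leader A p x \<and> cycle_leader B p y \<and> leader_rank A p x = leader_rank B p y}"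
  \<comment> \<open>\<open>h\<close> may be of any complexity. Only its finitely many values on
    \<open>V\<close> enter the pairing; the cycles are paired by length and rank without reference
    to \<open>h\<close>.\<close>
  define M where "M = C \<union> (\<lambda>v. (v, h v)) ` V"
  have "orbit_matching A B M"
    unfolding M_def
  proof (rule orbit_matchingI[OF A B])
    show "periodic A v \<and> periodic B v'" if "(v, v') \<in> C" for v v'
      using that unfolding C_def cycle_leader_def periodic_def by blast
    show "(A ^^ i) v = (A ^^ j) w \<longleftrightarrow> (B ^^ i) v' = (B ^^ j) w'"
      if vw: "(v, v') \<in> C" "(w, w') \<in> C" for v v' w w' i j
    proof -
      from vw obtain p q where p: "cycle_leader A p v" "cycle_leader B p v'" "leader_rank A p v = leader_rank B p v'"
        and q: "cycle_leader A q w" "cycle_leader B q w'" "leader_rank A q w = leader_rank B q w'"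
        unfolding C_def by blast
      show ?thesis
      proof (cases "p = q \<and> leader_rank A p v = leader_rank A q w")
        case True
        then have "v = w" "v' = w'" using p q leader_rank_eq_inj by metis+
        then show ?thesis using cycle_leader_funpow_eq[OF A p(1)] cycle_leader_funpow_eq[OF B p(2)] by simp
      next
        case False
        then have "\<not> conn A v w" "\<not> conn B v' w'"
          using cycle_leader_conn_eq[OF p(1) q(1)] cycle_leader_conn_eq[OF p(2) q(2)] p(3) q(3) by auto
        then show ?thesis using connI by blast
      qed
    qed
    show "\<exists>v v'. (v, v') \<in> C \<and> conn A x v" if "periodic A x" for x
    proof -
      obtain p v where v: "cycle_leader A p v" "conn A x v" using ex_cycle_leader[OF A \<open>periodic A x\<close>] by blast
      then show ?thesis using ex_leader_of_rank[OF B h v(1)] unfolding C_def by force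
    qed
    show "\<exists>v v'. (v, v') \<in> C \<and> conn B y v'" if "periodic B y" for y
    proof -
      obtain p v where v: "cycle_leader B p v" "conn B y v" using ex_cycle_leader[OF B \<open>periodic B y\<close>] by blast
      then show ?thesis using ex_leader_of_rank[OF A g v(1)] unfolding C_def by force
    qed
    show "\<not> periodic A v" if "v \<in> V" for v using V(1) that .
    show "v = w" if "v \<in> V" "w \<in> V" "conn A v w" for v w using V(2) that by blast
    show "\<exists>v\<in>V. conn A x v" if "\<not> periodic A x" for x using V(3) that by blast
    show "\<not> periodic B v" if "v \<in> h ` V" for v using that V(1) isomorphism_periodic[OF h] by auto
    show "v = w" if "v \<in> h ` V" "w \<in> h ` V" "conn B v w" for v w
      using that V(2) isomorphism_conn[OF h] by auto
    show "\<exists>v\<in>h ` V. conn B y v" if "\<not> periodic B y" for y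
    proof -
      obtain x where "y = h x" using h unfolding isomorphism_def by (metis bij_pointE)
      then show ?thesis using V(3)[of x] isomorphism_periodic[OF h] isomorphism_conn[OF h] that by blast
    qed
    show "inj_on h V" using isomorphism_inj[OF h] inj_on_subset by blast
    show "v \<in> range (A ^^ n) \<longleftrightarrow> h v \<in> range (B ^^ n)" for v n using isomorphism_range[OF h] by simp
  qed
  then interpret orbit_matching A B M .
  obtain f where f: "isomorphism A B f" "\<And>x y. f x = y \<longleftrightarrow> glue x y" using glue_isomorphism by blast
  let ?X = "char_fun (atomic_diagram B)"
  have Ar: "rec_definable ?X 1 (\<lambda>xs. A (hd xs))"
    using rec.definable_pr pr[unfolded primitive_recursive_iff] by blast
  note Br = rec_definable_atomic_diagram[of B]
  obtain L where L: "set L = V" using finite_list[OF fin] unfolding V_def by auto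
  \<comment> \<open>\<open>w\<close> codes the offset and, for cycles, two leaders with their common
    length \<open>p\<close>. The finite disjunction over \<open>V\<close> is a negated universal
    statement to fit the closure rule for lists; \<open>h\<close> enters through constants
    only.\<close>
  define Q where "Q w x y \<longleftrightarrow> (let i = fst (prod_decode w); j = fst (prod_decode (snd (prod_decode w)));
      v = fst (prod_decode (snd (prod_decode (snd (prod_decode w)))));
      v' = fst (prod_decode (snd (prod_decode (snd (prod_decode (snd (prod_decode w)))))));
      p = snd (prod_decode (snd (prod_decode (snd (prod_decode (snd (prod_decode w)))))))
    in (\<not> (\<forall>v\<in>set L. \<not> ((A ^^ i) x = (A ^^ j) v \<and> (B ^^ i) y = (B ^^ j) (h v)))) \<or>
      cycle_leader A p v \<and> cycle_leader B p v' \<and> leader_rank A p v = leader_rank B p v' \<and>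
      (A ^^ i) x = (A ^^ j) v \<and> (B ^^ i) y = (B ^^ j) v')" for w x y
  have "Delta_fun_in 1 ?X f"
  proof (rule Delta_fun_in_1I)
    show "rec_decidable ?X 3 (\<lambda>xs. Q (hd xs) (hd (tl xs)) (hd (tl (tl xs))))"
      unfolding Q_def Let_def
      by (intro rec.definable_intros rec.definable_funpow[OF Ar] rec.definable_funpow[OF Br]
          rec.decidable_Ball_list rec.decidable_cycle_leader[OF Ar] rec.decidable_cycle_leader[OF Br]
          rec.definable_leader_rank[OF Ar] rec.definable_leader_rank[OF Br]; simp)
    show "f x = y \<longleftrightarrow> (\<exists>w. Q w x y)" for x y
    proof
      assume "f x = y"
      then obtain v v' i j where M: "(v, v') \<in> M" and ij: "(A ^^ i) x = (A ^^ j) v" "(B ^^ i) y = (B ^^ j) v'"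
        unfolding f(2) glue_def by blast
      show "\<exists>w. Q w x y"
      proof (cases "(v, v') \<in> C")
        case True
        then obtain p where "cycle_leader A p v" "cycle_leader B p v'" "leader_rank A p v = leader_rank B p v'"
          unfolding C_def by blast
        then have "Q (prod_encode (i, prod_encode (j, prod_encode (v, prod_encode (v', p))))) x y"
          using ij unfolding Q_def by simp
        then show ?thesis ..
      next
        case False
        then have "v \<in> V" "v' = h v" using M unfolding M_def by auto
        then have "Q (prod_encode (i, prod_encode (j, 0))) x y" using ij L unfolding Q_def Let_def by auto
        then show ?thesis ..
      qed
    next
      assume "\<exists>w. Q w x y"
      moreover have "glue x y" if "v \<in> V" "(A ^^ i) x = (A ^^ j) v" "(B ^^ i) y = (B ^^ j) (h v)" for v i j
      proof -
        have "(v, h v) \<in> M" using that(1) unfolding M_def by blast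
        then show ?thesis using that(2,3) unfolding glue_def by blast
      qed
      moreover have "glue x y" if "cycle_leader A p v" "cycle_leader B p v'"
        "leader_rank A p v = leader_rank B p v'" "(A ^^ i) x = (A ^^ j) v" "(B ^^ i) y = (B ^^ j) v'" for v v' i j p
      proof -
        have "(v, v') \<in> M" using that(1-3) unfolding M_def C_def by blast
        then show ?thesis using that(4,5) unfolding glue_def by blast
      qed
      ultimately show "f x = y" unfolding f(2) Q_def Let_def L by metis
    qed
  qed
  then show "\<exists>h. isomorphism A B h \<and> Delta_fun_in 1 (char_fun (atomic_diagram B)) h" using f(1) by blast
qed


section \<open>Structures with rows that die or live forever\<close>

definition has_period :: "structure_1 \<Rightarrow> nat \<Rightarrow> nat \<Rightarrow> bool" where
  "has_period A x p \<longleftrightarrow> p > 0 \<and> (A ^^ p) x = x \<and> (\<forall>q<p. q > 0 \<longrightarrow> (A ^^ q) x \<noteq> x)"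

lemma has_period_unique: "has_period A x p \<Longrightarrow> has_period A x q \<Longrightarrow> p = q"
  unfolding has_period_def by (metis linorder_neqE_nat)

lemma periodic_has_period: "periodic A x \<Longrightarrow> \<exists>p. has_period A x p"
  unfolding periodic_def has_period_def
  using exists_least_iff[of "\<lambda>p. p > 0 \<and> (A ^^ p) x = x"] by blast

lemma has_period_funpow:
  assumes A: "inj A"
  shows "has_period A ((A ^^ i) x) p \<longleftrightarrow> has_period A x p"
proof -
  have "(A ^^ q) ((A ^^ i) x) = (A ^^ i) x \<longleftrightarrow> (A ^^ q) x = x" for q
  proof -
    have "(A ^^ q) ((A ^^ i) x) = (A ^^ i) ((A ^^ q) x)"
      by (simp flip: funpow_add comp_apply[of "A ^^ _"] add: add.commute)
    then show ?thesis using funpow_cancel[OF A, of i] by metis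
  qed
  then show ?thesis unfolding has_period_def by simp
qed

definition code :: "nat \<Rightarrow> nat \<Rightarrow> nat \<Rightarrow> nat" where
  "code g u v = prod_encode (g, prod_encode (u, v))"

definition code_tag :: "nat \<Rightarrow> nat" where "code_tag x = fst (prod_decode x)"
definition code_row :: "nat \<Rightarrow> nat" where "code_row x = fst (prod_decode (snd (prod_decode x)))"
definition code_col :: "nat \<Rightarrow> nat" where "code_col x = snd (prod_decode (snd (prod_decode x)))"

lemma code_simps [simp]:
  "code_tag (code g u v) = g" "code_row (code g u v) = u" "code_col (code g u v) = v"
  "code (code_tag x) (code_row x) (code_col x) = x"
  "code g u v = code g' u' v' \<longleftrightarrow> g = g' \<and> u = u' \<and> v = v'"
  unfolding code_def code_tag_def code_row_def code_col_def by auto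

lemma row_le_code: "u \<le> code g u v"
  unfolding code_def by (meson le_prod_encode_1 le_prod_encode_2 le_trans)

text \<open>The nodes are the points \<open>(x, p)\<close> of cycles of \<open>A\<close> (tag 0), the points of the orbits of the
  other infinite type (tag 1), row \<open>u\<close> at column \<open>t\<close> as long as it is live (tag 2), and, for
  two-sided orbits, a left part leading into row \<open>u\<close> (tag 3), which extends as far as row \<open>u - 1\<close>
  lives. A row that dies continues with the left part of the next row, or with that row itself.
  Numbers that code no node are inserted in row 0.\<close>

locale row_structure =
  fixes A :: structure_1 and live :: "nat \<Rightarrow> nat \<Rightarrow> bool" and two :: bool and I :: "nat set"
  assumes inj_A: "inj A"
    and live_row_0 [simp]: "live 0 t"
    and live_col_0 [simp]: "live u 0"
    and live_antimono: "live u t \<Longrightarrow> s \<le> t \<Longrightarrow> live u s"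
    and ex_immortal: "\<exists>u\<ge>n. \<forall>t. live u t"
begin

text \<open>A constant rather than the parameter, which the simplifier would replace inside other constants.\<close>

definition twosided_rows :: bool where "twosided_rows \<longleftrightarrow> two"

definition node :: "nat \<Rightarrow> bool" where
  "node x \<longleftrightarrow> code_tag x = 0 \<and> has_period A (code_row x) (code_col x)
     \<or> code_tag x = 1 \<and> code_row x \<in> I
     \<or> code_tag x = 2 \<and> live (code_row x) (code_col x)
     \<or> code_tag x = 3 \<and> twosided_rows \<and> (code_row x = 0 \<or> live (code_row x - 1) (code_col x))"

text \<open>If the rows are two-sided, the other orbits are omega-chains through the columns 0, 1, 2
  and so on. Otherwise they are two-sided: odd columns descend to 1, then truncated subtraction
  gives \<open>1 - 2 = 0\<close>, and even columns ascend.\<close>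

definition other_succ :: "nat \<Rightarrow> nat" where
  "other_succ t = (if twosided_rows then Suc t else if even t then t + 2 else t - 2)"

text \<open>A number \<open>t\<close> that codes no node is visited between columns \<open>t\<close>
  and \<open>Suc t\<close> of row 0, so \<open>S\<close> is defined on all numbers without
  renumbering. In the two-sided case a row with last column \<open>t\<close> enters the left part of
  its successor at column \<open>t\<close>, the far end of that part.\<close>

definition S :: structure_1 where
  "S x = (if \<not> node x then code 2 0 (Suc x)
     else if code_tag x = 0 then code 0 (A (code_row x)) (code_col x)
     else if code_tag x = 1 then code 1 (code_row x) (other_succ (code_col x))
     else if code_tag x = 2 then
       (if code_row x = 0 then if node (code_col x) then code 2 0 (Suc (code_col x)) else code_col x
        else if live (code_row x) (Suc (code_col x)) then code 2 (code_row x) (Suc (code_col x))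
        else if twosided_rows then code 3 (Suc (code_row x)) (code_col x)
        else code 2 (Suc (code_row x)) 0)
     else if code_col x = 0 then code 2 (code_row x) 0 else code 3 (code_row x) (code_col x - 1))"

definition immortal :: "nat \<Rightarrow> bool" where "immortal u \<longleftrightarrow> (\<forall>t. live u t)"
text \<open>Mortal rows merge with their successors, so the orbits made of rows are blocks that end
  in an immortal row. The starts are the first rows of the blocks and pick one row for each
  orbit.\<close>

definition starts :: "nat set" where "starts = {u. u = 0 \<or> immortal (u - 1)}"
definition next_immortal :: "nat \<Rightarrow> nat" where "next_immortal u = (LEAST w. u \<le> w \<and> immortal w)"

text \<open>The label of a node tells its infinite orbit: \<open>(1, i)\<close> for the orbits outside the rows and
  \<open>(2, u)\<close> for the orbit containing the immortal row \<open>u\<close>.\<close>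

definition label :: "nat \<Rightarrow> nat \<times> nat" where
  "label x = (if \<not> node x then (2, next_immortal 0)
     else if code_tag x = 0 then (0, 0)
     else if code_tag x = 1 then (1, code_row x)
     else (2, next_immortal (code_row x)))"

lemma node_code [simp]:
  "node (code 0 u p) \<longleftrightarrow> has_period A u p"
  "node (code (Suc 0) u t) \<longleftrightarrow> u \<in> I"
  "node (code 2 u t) \<longleftrightarrow> live u t"
  "node (code 3 u t) \<longleftrightarrow> twosided_rows \<and> (u = 0 \<or> live (u - 1) t)"
  unfolding node_def by auto

lemma S_pad: "\<not> node x \<Longrightarrow> S x = code 2 0 (Suc x)"
  unfolding S_def by simp

lemma S_cycle: "has_period A u p \<Longrightarrow> S (code 0 u p) = code 0 (A u) p"
  unfolding S_def by simp

lemma S_other: "i \<in> I \<Longrightarrow> S (code (Suc 0) i t) = code (Suc 0) i (other_succ t)"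
  unfolding S_def by simp

lemma S_row_0: "S (code 2 0 t) = (if node t then code 2 0 (Suc t) else t)"
  unfolding S_def by simp

lemma S_row: "u \<noteq> 0 \<Longrightarrow> live u t \<Longrightarrow> S (code 2 u t) = (if live u (Suc t) then code 2 u (Suc t)
     else if twosided_rows then code 3 (Suc u) t else code 2 (Suc u) 0)"
  unfolding S_def by simp

lemma S_left: "twosided_rows \<Longrightarrow> u = 0 \<or> live (u - 1) t \<Longrightarrow>
    S (code 3 u t) = (if t = 0 then code 2 u 0 else code 3 u (t - 1))"
  unfolding S_def by simp

lemma node_cases [case_names pad cycle other row_0 row left]:
  obtains "\<not> node x"
  | u p where "x = code 0 u p" "has_period A u p"
  | i t where "x = code 1 i t" "i \<in> I"
  | t where "x = code 2 0 t"
  | u t where "x = code 2 u t" "u \<noteq> 0" "live u t"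
  | u t where "x = code 3 u t" "twosided_rows" "u = 0 \<or> live (u - 1) t"
proof -
  have "x = code (code_tag x) (code_row x) (code_col x)" by simp
  then show thesis using that unfolding node_def by metis
qed

lemma next_immortal: "u \<le> next_immortal u" "immortal (next_immortal u)"
  unfolding next_immortal_def immortal_def using LeastI_ex[OF ex_immortal[of u]] by auto

lemma next_immortal_le: "u \<le> w \<Longrightarrow> immortal w \<Longrightarrow> next_immortal u \<le> w"
  unfolding next_immortal_def by (rule Least_le) simp

lemma immortal_0: "immortal 0"
  unfolding immortal_def using live_row_0 by blast

lemma next_immortal_mortal: "\<not> immortal u \<Longrightarrow> next_immortal (Suc u) = next_immortal u"
  by (metis Suc_leD Suc_leI le_antisym le_neq_implies_less next_immortal next_immortal_le)

lemma next_immortal_immortal: "immortal u \<Longrightarrow> next_immortal u = u"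
  by (metis le_antisym le_refl next_immortal(1) next_immortal_le)

lemma inj_S: "inj S"
proof (rule injI)
  \<comment> \<open>A row has only one last live column, so it is left from one point only.\<close>
  have dead: "s = t" if "live u s" "\<not> live u (Suc s)" "live u t" "\<not> live u (Suc t)" for u s t
    using that live_antimono by (metis Suc_leI linorder_neqE_nat)
  have other: "other_succ t = other_succ t' \<longleftrightarrow> t = t'" for t t'
    unfolding other_succ_def by (auto split: if_splits elim!: oddE evenE) presburger+
  have pred: "live u t \<Longrightarrow> live u (t - Suc 0)" for u t
    using live_antimono by simp
  have period: "has_period A (A u) p \<longleftrightarrow> has_period A u p" for u p
    using has_period_funpow[OF inj_A, of 1] by simp
  fix x y assume "S x = S y"
  then show "x = y"
    by (cases x rule: node_cases; cases y rule: node_cases)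
      (auto simp: S_pad S_cycle S_other S_row_0 S_row S_left other period pred split: if_splits
        dest: injD[OF inj_A] dead)
qed

section \<open>Labels and the orbits of a row structure\<close>

lemma label_code [simp]:
  "has_period A u p \<Longrightarrow> label (code 0 u p) = (0, 0)"
  "u \<in> I \<Longrightarrow> label (code (Suc 0) u t) = (1, u)"
  "live u t \<Longrightarrow> label (code 2 u t) = (2, next_immortal u)"
  "twosided_rows \<Longrightarrow> u = 0 \<or> live (u - 1) t \<Longrightarrow> label (code 3 u t) = (2, next_immortal u)"
  "\<not> node x \<Longrightarrow> label x = (2, next_immortal 0)"
  unfolding label_def by auto

lemma label_S: "label (S x) = label x"
proof (cases x rule: node_cases)
  case pad
  then show ?thesis by (simp add: S_pad)
next
  case (cycle u p)
  moreover from this have "has_period A (A u) p" using has_period_funpow[OF inj_A, of 1] by simp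
  ultimately show ?thesis by (simp add: S_cycle)
next
  case (other i t)
  then show ?thesis by (simp add: S_other)
next
  case (row_0 t)
  then show ?thesis by (simp add: S_row_0)
next
  case (row u t)
  \<comment> \<open>Only a mortal row is left for the next one, and then both have the same next
    immortal row.\<close>
  then have "next_immortal (Suc u) = next_immortal u" if "\<not> live u (Suc t)"
    using that next_immortal_mortal unfolding immortal_def by blast
  then show ?thesis using row by (simp add: S_row)
next
  case (left u t)
  then have "u = 0 \<or> live (u - 1) (t - 1)" using live_antimono by (meson diff_le_self)
  then show ?thesis using left by (simp add: S_left)
qed

lemma label_funpow: "label ((S ^^ k) x) = label x"
  by (induction k) (auto simp: label_S)

lemma label_conn: "conn S x y \<Longrightarrow> label x = label y"
  unfolding conn_def using label_funpow by metis

lemma conn_row: "live u t \<Longrightarrow> conn S (code 2 u t) (code 2 u 0)"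
proof (induction t)
  case (Suc t)
  then have live: "live u t" using live_antimono by (meson le_Suc_eq order_refl)
  have "conn S (code 2 u (Suc t)) (code 2 u t)"
  proof (cases "u = 0 \<and> \<not> node t")
    case True
    \<comment> \<open>The way to the next column passes through the number inserted after this
      column.\<close>
    then have "S (S (code 2 u t)) = code 2 u (Suc t)" by (simp add: S_row_0 S_pad)
    then show ?thesis using conn_funpow[of S 2 "code 2 u t"] by (simp add: numeral_2_eq_2)
  next
    case False
    then have "S (code 2 u t) = code 2 u (Suc t)" using Suc.prems live
      by (cases "u = 0") (auto simp: S_row_0 S_row)
    then show ?thesis using conn_step by metis
  qed
  then show ?case using Suc.IH[OF live] conn_trans by blast
qed (rule conn_refl)

lemma funpow_left: "twosided_rows \<Longrightarrow> u = 0 \<or> live (u - 1) t \<Longrightarrow> (S ^^ Suc t) (code 3 u t) = code 2 u 0"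
proof (induction t)
  case (Suc t)
  then have *: "u = 0 \<or> live (u - 1) t" using live_antimono by (meson le_Suc_eq order_refl)
  have "(S ^^ Suc (Suc t)) (code 3 u (Suc t)) = (S ^^ Suc t) (S (code 3 u (Suc t)))"
    by (simp add: funpow_swap1)
  then show ?case using Suc * by (simp add: S_left)
qed (simp add: S_left)

lemma conn_left: "twosided_rows \<Longrightarrow> u = 0 \<or> live (u - 1) t \<Longrightarrow> conn S (code 3 u t) (code 2 u 0)"
  using funpow_left conn_funpow conn_sym by metis

lemma conn_mortal:
  assumes "\<not> immortal u"
  shows "conn S (code 2 (Suc u) 0) (code 2 u 0)"
proof -
  have u: "u \<noteq> 0" using assms immortal_0 by metis
  obtain s where "\<not> live u s" using assms unfolding immortal_def by blast
  then obtain t where t: "live u t" "\<not> live u (Suc t)" by (induction s) auto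
  have "conn S (S (code 2 u t)) (code 2 (Suc u) 0)"
    using conn_left[of "Suc u" t] t u by (auto simp: S_row conn_refl)
  then show ?thesis using conn_row[OF t(1)] conn_step conn_sym conn_trans by blast
qed

lemma conn_start: "\<exists>w\<in>starts. conn S (code 2 u 0) (code 2 w 0)"
proof (induction u)
  case (Suc u)
  then show ?case
  proof (cases "immortal u")
    case True
    then have "Suc u \<in> starts" unfolding starts_def by simp
    then show ?thesis using conn_refl by blast
  qed (use conn_mortal conn_trans in blast)
qed (auto simp: starts_def intro: conn_refl)

lemma conn_next_immortal: "conn S (code 2 u 0) (code 2 (next_immortal u) 0)"
proof -
  have "u \<le> w \<Longrightarrow> w \<le> next_immortal u \<Longrightarrow> conn S (code 2 u 0) (code 2 w 0)" for w
  proof (induction w rule: dec_induct)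
    case (step w)
    then have "\<not> immortal w" using next_immortal_le[of u w] by linarith
    then show ?case using step conn_mortal[of w] conn_sym conn_trans by (meson Suc_leD)
  qed (rule conn_refl)
  then show ?thesis using next_immortal by blast
qed

lemma conn_other:
  assumes i: "i \<in> I"
  shows "conn S (code (Suc 0) i t) (code (Suc 0) i 0)"
proof (induction t rule: less_induct)
  case (less t)
  show ?case
  proof (cases "t = 0")
    case False
    show ?thesis
    proof (cases "twosided_rows")
      case True
      then have "S (code (Suc 0) i (t - 1)) = code (Suc 0) i t" using S_other[OF i, of "t - 1"] other_succ_def False by simp
      then show ?thesis using less[of "t - 1"] False conn_step conn_trans by (metis diff_less less_one neq0_conv)
    next
      case rows: False
      show ?thesis
      proof (cases "even t")
        case True
        then have "S (code (Suc 0) i (t - 2)) = code (Suc 0) i t" using S_other[OF i, of "t - 2"] other_succ_def False rows by (auto elim!: evenE)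
        then show ?thesis using less[of "t - 2"] False conn_step conn_trans by (metis diff_less neq0_conv zero_less_numeral)
      next
        case odd: False
        then have "S (code (Suc 0) i t) = code (Suc 0) i (t - 2)" using S_other[OF i, of t] other_succ_def rows by simp
        then show ?thesis using less[of "t - 2"] False conn_step conn_sym conn_trans by (metis diff_less neq0_conv zero_less_numeral)
      qed
    qed
  qed (simp add: conn_refl)
qed

lemma conn_rows:
  assumes "fst (label x) = 2"
  obtains u where "u \<in> starts" "conn S x (code 2 u 0)"
proof -
  have "\<exists>u. conn S x (code 2 u 0)"
  proof (cases x rule: node_cases)
    case pad
    then have "conn S x (code 2 0 (Suc x))" using conn_step[of S x] S_pad conn_sym by metis
    then show ?thesis using conn_row conn_trans live_row_0 by blast
  next
    case (left u t)
    then show ?thesis using conn_left by blast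
  next
    case (row u t)
    then show ?thesis using conn_row by blast
  next
    case (row_0 t)
    then show ?thesis using conn_row live_row_0 by blast
  qed (use assms in auto)
  then show thesis using conn_start conn_trans that by metis
qed

text \<open>If \<open>u < w\<close> are starts, row \<open>w - 1\<close> is immortal and not before
  \<open>u\<close>, so the block of \<open>u\<close> ends before \<open>w\<close>.\<close>

lemma starts_next_immortal_inj:
  assumes "u \<in> starts" "w \<in> starts" "next_immortal u = next_immortal w"
  shows "u = w"
proof -
  have "\<not> u < w" if "w \<in> starts" "next_immortal u = next_immortal w" for u w
  proof
    assume "u < w"
    then have "u \<le> w - 1" "w \<noteq> 0" by auto
    then have "next_immortal u \<le> w - 1" using that next_immortal_le unfolding starts_def by blast
    then show False using that next_immortal(1)[of w] \<open>w \<noteq> 0\<close> by simp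
  qed
  then show ?thesis using assms by (metis linorder_neqE_nat)
qed

lemma label_eq_conn:
  assumes "fst (label x) = 2" "label x = label y"
  shows "conn S x y"
proof -
  obtain u where u: "u \<in> starts" "conn S x (code 2 u 0)" using assms(1) by (rule conn_rows)
  obtain w where w: "w \<in> starts" "conn S y (code 2 w 0)" using assms by (metis conn_rows)
  have "next_immortal u = next_immortal w"
    using label_conn[OF u(2)] label_conn[OF w(2)] assms(2) by simp
  then show ?thesis using starts_next_immortal_inj u w conn_sym conn_trans by metis
qed

text \<open>The claim is moved to the immortal row of the orbit. From there the orbit never leaves
  this row and its inserted numbers, and the position strictly increases.\<close>

lemma not_periodic_row: "\<not> periodic S (code 2 u 0)"
proof -
  define w where "w = next_immortal u"
  \<comment> \<open>Columns get even ranks and inserted numbers odd ones: the number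
    \<open>x\<close> lies between columns \<open>x\<close> and \<open>Suc x\<close> of row
    0.\<close>
  define rank where "rank x = (if node x then 2 * code_col x else Suc (2 * x))" for x
  define T where "T = {x. node x \<and> code_tag x = 2 \<and> code_row x = w \<or> w = 0 \<and> \<not> node x}"
  have w: "live w t" for t using next_immortal(2)[of u] unfolding w_def immortal_def by blast
  have step: "S x \<in> T \<and> rank x < rank (S x)" if "x \<in> T" for x
  proof (cases x rule: node_cases)
    case pad
    then show ?thesis using that unfolding T_def rank_def by (simp add: S_pad)
  next
    case (row_0 t)
    then show ?thesis using that unfolding T_def rank_def by (simp add: S_row_0)
  next
    case (row u t)
    then show ?thesis using that w unfolding T_def rank_def by (simp add: S_row)
  qed (use that in \<open>auto simp: T_def\<close>)
  have "(S ^^ k) x \<in> T \<and> rank x + k \<le> rank ((S ^^ k) x)" if "x \<in> T" for x k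
  proof (induction k)
    case (Suc k)
    then show ?case using step[of "(S ^^ k) x"] by simp
  qed (use that in simp)
  moreover have "code 2 w 0 \<in> T" unfolding T_def by simp
  ultimately have "\<not> periodic S (code 2 w 0)" unfolding periodic_def by (metis add_le_same_cancel1 not_le)
  then show ?thesis using conn_next_immortal[of u] periodic_conn[OF inj_S] unfolding w_def by blast
qed

lemma funpow_other_twosided: "twosided_rows \<Longrightarrow> i \<in> I \<Longrightarrow> (S ^^ k) (code (Suc 0) i 0) = code (Suc 0) i k"
  by (induction k) (use S_other other_succ_def in auto)

lemma funpow_other: "\<not> twosided_rows \<Longrightarrow> i \<in> I \<Longrightarrow> (S ^^ k) (code (Suc 0) i 0) = code (Suc 0) i (2 * k)"
  by (induction k) (use S_other other_succ_def in auto)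

lemma not_periodic_other: "i \<in> I \<Longrightarrow> \<not> periodic S (code (Suc 0) i 0)"
  using funpow_other_twosided[of i] funpow_other[of i] unfolding periodic_def
  by (cases twosided_rows) auto

lemma other_depth:
  assumes i: "i \<in> I"
  shows "code (Suc 0) i 0 \<in> (if twosided_rows then roots S else twosided S)"
proof (cases twosided_rows)
  case True
  have "S x \<noteq> code (Suc 0) i 0" for x
  proof
    assume x: "S x = code (Suc 0) i 0"
    then have "label x = (Suc 0, i)" using label_S[of x] i by simp
    then obtain j t where "x = code (Suc 0) j t" "j \<in> I" by (cases x rule: node_cases) auto
    then show False using S_other[of j t] other_succ_def x True by simp
  qed
  then have "code (Suc 0) i 0 \<notin> range S" by (metis imageE)
  then show ?thesis using True unfolding roots_def by simp
next
  case False
  have *: "(S ^^ Suc k) (code (Suc 0) i (2 * k + 1)) = code (Suc 0) i 0" for k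
  proof (induction k)
    case 0
    then show ?case using S_other[OF i, of 1] other_succ_def False by simp
  next
    case (Suc k)
    have "(S ^^ Suc (Suc k)) (code (Suc 0) i (2 * Suc k + 1)) = (S ^^ Suc k) (S (code (Suc 0) i (2 * Suc k + 1)))"
      by (simp add: funpow_swap1)
    also have "S (code (Suc 0) i (2 * Suc k + 1)) = code (Suc 0) i (2 * k + 1)"
      using S_other[OF i, of "2 * Suc k + 1"] other_succ_def False by simp
    finally show ?case using Suc by simp
  qed
  have "code (Suc 0) i 0 \<in> range (S ^^ k)" for k
    by (cases k) (use * in \<open>auto intro: range_eqI[OF sym]\<close>)
  then show ?thesis using False not_periodic_other[OF i] unfolding twosided_def by simp
qed

text \<open>For a start \<open>u\<close> the preceding row, if there is one, never dies. So nothing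
  enters row \<open>u\<close> from it, and the left part, if present, is infinite.\<close>

lemma row_depth:
  assumes u: "u \<in> starts"
  shows "code 2 u 0 \<in> (if twosided_rows then twosided S else roots S)"
proof (cases twosided_rows)
  case True
  have "u = 0 \<or> live (u - 1) k" for k using u unfolding starts_def immortal_def by blast
  from funpow_left[OF True this] have "code 2 u 0 \<in> range (S ^^ k)" for k
    by (cases k) (auto intro: range_eqI[OF sym])
  then show ?thesis using True not_periodic_row unfolding twosided_def by simp
next
  case False
  have "S x \<noteq> code 2 u 0" for x
    using u False by (cases x rule: node_cases)
      (auto simp: S_pad S_cycle S_other S_row_0 S_row starts_def immortal_def)
  then have "code 2 u 0 \<notin> range S" by (metis imageE)
  then show ?thesis using False unfolding roots_def by simp
qed

text \<open>Rows are the only orbits of their type, and isomorphisms preserve types. So an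
  isomorphism between two row structures with the same \<open>two\<close> sends row orbits to row
  orbits.\<close>

lemma label_row_type:
  assumes "x \<in> (if twosided_rows then twosided S else roots S)"
  shows "fst (label x) = 2"
proof (rule ccontr)
  have np: "\<not> periodic S x"
    using assms root_not_periodic unfolding twosided_def by (auto split: if_splits)
  assume l: "fst (label x) \<noteq> 2"
  then show False
  proof (cases x rule: node_cases)
    case (cycle u p)
    have "(S ^^ k) (code 0 u p) = code 0 ((A ^^ k) u) p" for k
      by (induction k) (use cycle has_period_funpow[OF inj_A] in \<open>auto simp: S_cycle\<close>)
    then have "periodic S x" using cycle unfolding periodic_def has_period_def by auto
    then show False using np by blast
  next
    case (other i t)
    have disj: "y \<notin> roots S" if "y \<in> twosided S" for y
      using that root_in_range_funpow[of y S 1] unfolding twosided_def by fastforce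
    have "conn S x (code (Suc 0) i 0)" using conn_other other by simp
    then show False using other_depth[OF other(2)] assms disj twosided_conn[OF inj_S] conn_sym
      by (metis (full_types))
  qed auto
qed

end


section \<open>Row structures as punctual copies of \<open>A\<close>, and counting their
  orbits\<close>

context row_structure
begin

lemma infinite_starts: "infinite starts"
proof -
  have "\<exists>u\<ge>n. u \<in> starts" for n
  proof -
    obtain u where "u \<ge> n" "\<forall>t. live u t" using ex_immortal by blast
    then have "Suc u \<ge> n" "Suc u \<in> starts" unfolding starts_def immortal_def by auto
    then show ?thesis by blast
  qed
  then show ?thesis by (meson finite_nat_set_iff_bounded leD)
qed

text \<open>The three kinds of orbits are matched separately: a periodic \<open>x\<close> with its
  pair \<open>(x, p)\<close>, the orbits of the row type with the blocks of rows, as both index sets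
  are infinite subsets of omega, and the others through \<open>kE\<close>.\<close>

lemma isomorphic:
  assumes inf: "infinite (if twosided_rows then twosided_reps A else roots A)" (is "infinite ?VR")
    and kE: "bij_betw kE (if twosided_rows then roots A else twosided_reps A) I" (is "bij_betw _ ?VE _")
  shows "\<exists>h. isomorphism A S h"
proof -
  have disj: "v \<notin> roots A" if "v \<in> twosided_reps A" for v
    using that root_in_range_funpow[of v A 1] unfolding twosided_reps_def twosided_def by fastforce
  have "bij_betw (enumerate starts \<circ> inv_into UNIV (enumerate ?VR)) ?VR starts"
    using bij_betw_trans[OF bij_betw_inv_into[OF bij_enumerate[OF inf]] bij_enumerate[OF infinite_starts]] .
  then obtain kR where kR: "bij_betw kR ?VR starts" by blast
  define V where "V = roots A \<union> twosided_reps A"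
  note V = infinite_orbit_reps[OF inj_A, folded V_def]
  have V_split: "V = ?VE \<union> ?VR" "?VE \<inter> ?VR = {}" using disj unfolding V_def by auto
  define k where "k v = (if v \<in> ?VR then code 2 (kR v) 0 else code (Suc 0) (kE v) 0)" for v
  have k_VR: "k v = code 2 (kR v) 0" "kR v \<in> starts" if "v \<in> ?VR" for v
    using that bij_betwE[OF kR] unfolding k_def by auto
  have k_VE: "k v = code (Suc 0) (kE v) 0" "kE v \<in> I" if "v \<in> ?VE" for v
    using that bij_betwE[OF kE] V_split(2) unfolding k_def by auto
  have k_image: "k ` V = (\<lambda>u. code 2 u 0) ` starts \<union> (\<lambda>i. code (Suc 0) i 0) ` I"
  proof -
    have "k ` ?VR = (\<lambda>u. code 2 u 0) ` kR ` ?VR" "k ` ?VE = (\<lambda>i. code (Suc 0) i 0) ` kE ` ?VE"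
      using k_VR(1) k_VE(1) by (simp_all add: image_image)
    then show ?thesis
      unfolding V_split(1) image_Un bij_betw_imp_surj_on[OF kR] bij_betw_imp_surj_on[OF kE] by blast
  qed
  define C where "C = {(x, code 0 x p) | x p. has_period A x p}"
  have cycle: "(S ^^ i) (code 0 v p) = code 0 ((A ^^ i) v) p" if "has_period A v p" for i v p
    by (induction i) (use that has_period_funpow[OF inj_A] in \<open>auto simp: S_cycle\<close>)
  have "orbit_matching A S (C \<union> (\<lambda>v. (v, k v)) ` V)"
  proof (rule orbit_matchingI[OF inj_A inj_S])
    show "periodic A v \<and> periodic S v'" if vv: "(v, v') \<in> C" for v v'
    proof -
      obtain p where p: "has_period A v p" "v' = code 0 v p" using vv unfolding C_def by blast
      then have "p > 0" "(A ^^ p) v = v" unfolding has_period_def by auto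
      then show ?thesis using cycle[OF p(1), of p] p(2) unfolding periodic_def by auto
    qed
    show "(A ^^ i) v = (A ^^ j) w \<longleftrightarrow> (S ^^ i) v' = (S ^^ j) w'"
      if vw: "(v, v') \<in> C" "(w, w') \<in> C" for v v' w w' i j
    proof -
      obtain p q where p: "has_period A v p" "v' = code 0 v p" and q: "has_period A w q" "w' = code 0 w q"
        using vw unfolding C_def by blast
      have "p = q" if "(A ^^ i) v = (A ^^ j) w"
        using has_period_funpow[OF inj_A, of i v p] has_period_funpow[OF inj_A, of j w q]
          p(1) q(1) that has_period_unique by metis
      then show ?thesis using cycle[OF p(1)] cycle[OF q(1)] p(2) q(2) by auto
    qed
    show "\<exists>v v'. (v, v') \<in> C \<and> conn A x v" if "periodic A x" for x
      using periodic_has_period[OF that] conn_refl unfolding C_def by blast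
    show "\<exists>v v'. (v, v') \<in> C \<and> conn S y v'" if y: "periodic S y" for y
    proof (cases y rule: node_cases)
      case (cycle u p)
      then show ?thesis using conn_refl unfolding C_def by blast
    next
      case (other i t)
      then have "conn S y (code (Suc 0) i 0)" using conn_other by simp
      then show ?thesis using periodic_conn[OF inj_S _ y] not_periodic_other[OF other(2)] by blast
    next
      case pad
      then have "fst (label y) = 2" by simp
      then show ?thesis using conn_rows[of y] periodic_conn[OF inj_S _ y] not_periodic_row by metis
    next
      case (row_0 t)
      then have "fst (label y) = 2" by simp
      then show ?thesis using conn_rows[of y] periodic_conn[OF inj_S _ y] not_periodic_row by metis
    next
      case (row u t)
      then have "fst (label y) = 2" by simp
      then show ?thesis using conn_rows[of y] periodic_conn[OF inj_S _ y] not_periodic_row by metis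
    next
      case (left u t)
      then have "fst (label y) = 2" by simp
      then show ?thesis using conn_rows[of y] periodic_conn[OF inj_S _ y] not_periodic_row by metis
    qed
    show "\<not> periodic A v" if "v \<in> V" for v using V(1) that .
    show "v = w" if "v \<in> V" "w \<in> V" "conn A v w" for v w using V(2) that by blast
    show "\<exists>v\<in>V. conn A x v" if "\<not> periodic A x" for x using V(3) that by blast
    show "\<not> periodic S v" if "v \<in> k ` V" for v
      using that not_periodic_row not_periodic_other unfolding k_image by auto
    show "v = w" if vw: "v \<in> k ` V" "w \<in> k ` V" "conn S v w" for v w
      using vw(1,2) label_conn[OF vw(3)] starts_next_immortal_inj unfolding k_image by auto
    show "\<exists>v\<in>k ` V. conn S y v" if y: "\<not> periodic S y" for y
    proof (cases "fst (label y) = 2")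
      case True
      then show ?thesis using conn_rows[OF True] unfolding k_image by blast
    next
      case False
      then show ?thesis
      proof (cases y rule: node_cases)
        case (cycle u p)
        then have "(S ^^ p) y = y \<and> p > 0"
          using \<open>\<And>v p i. has_period A v p \<Longrightarrow> (S ^^ i) (code 0 v p) = code 0 ((A ^^ i) v) p\<close>[of u p p]
          unfolding has_period_def by simp
        then show ?thesis using y unfolding periodic_def by blast
      next
        case (other i t)
        then show ?thesis using conn_other[of i t] unfolding k_image by auto
      qed auto
    qed
    show "inj_on k V"
    proof (rule inj_onI)
      fix v w assume vw: "v \<in> V" "w \<in> V" "k v = k w"
      then show "v = w"
        using k_VR[of v] k_VR[of w] k_VE[of v] k_VE[of w]
          inj_onD[OF bij_betw_imp_inj_on[OF kR], of v w] inj_onD[OF bij_betw_imp_inj_on[OF kE], of v w]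
        unfolding V_split(1) Un_iff by (metis code_simps(1,2) Suc_inject numeral_2_eq_2 zero_neq_one One_nat_def)
    qed
    show "v \<in> range (A ^^ n) \<longleftrightarrow> k v \<in> range (S ^^ n)" if v: "v \<in> V" for v n
    proof -
      have "v \<in> roots A \<and> k v \<in> roots S \<or> v \<in> twosided A \<and> k v \<in> twosided S"
      proof (cases "v \<in> ?VR")
        case True
        then show ?thesis using k_VR[OF True] row_depth[of "kR v"]
          by (auto simp: twosided_reps_def split: if_splits)
      next
        case False
        then have VE: "v \<in> ?VE" using v V_split by blast
        then show ?thesis using k_VE[OF VE] other_depth[of "kE v"]
          by (auto simp: twosided_reps_def split: if_splits)
      qed
      then show ?thesis
      proof
        assume "v \<in> roots A \<and> k v \<in> roots S"
        then show ?thesis using root_in_range_funpow by metis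
      next
        assume "v \<in> twosided A \<and> k v \<in> twosided S"
        then show ?thesis unfolding twosided_def by blast
      qed
    qed
  qed
  then show ?thesis using orbit_matching.glue_isomorphism by blast
qed

lemma primitive_recursive_S:
  assumes A: "primitive_recursive A"
    and live: "pr_decidable 2 (\<lambda>xs. live (hd xs) (hd (tl xs)))"
    and I: "pr_decidable 1 (\<lambda>xs. hd xs \<in> I)"
  shows "primitive_recursive S"
proof -
  note A = A[unfolded primitive_recursive_iff]
  note app_live = pr.definable_app2[where f = "\<lambda>u t. of_bool (live u t)", OF live]
  note app_I = pr.definable_app1[where f = "\<lambda>i. of_bool (i \<in> I)", OF I]
  have "pr_decidable 1 (\<lambda>xs. node (hd xs))"
    unfolding node_def code_tag_def code_row_def code_col_def has_period_def
    by (intro pr.definable_intros pr.definable_funpow[OF A] app_live app_I; simp)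
  note app_node = pr.definable_app1[where f = "\<lambda>x. of_bool (node x)", OF this]
  show ?thesis
    unfolding primitive_recursive_iff S_def code_def code_tag_def code_row_def code_col_def other_succ_def
    by (intro pr.definable_intros pr.definable_app1[OF A] pr.decidable_even app_live app_node; simp)
qed

text \<open>A code is at least its row number, and inserted numbers belong to row 0. Thus a bound on
  points bounds the rows of their orbits, as needed for counting.\<close>

lemma label_row_le: "fst (label x) = 2 \<Longrightarrow> \<exists>r\<le>x. label x = (2, next_immortal r)"
proof (cases x rule: node_cases)
  case pad
  then show ?thesis by (intro exI[of _ 0]) simp
next
  case (row_0 t)
  then show ?thesis by (intro exI[of _ 0]) simp
next
  case (row u t)
  then show ?thesis by (intro exI[of _ u]) (simp add: row_le_code)
next
  case (left u t)
  then show ?thesis by (intro exI[of _ u]) (simp add: row_le_code)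
qed auto

text \<open>Pigeonhole: points of distinct row orbits that are all at most \<open>M\<close> lie in orbits of immortal
  rows up to \<open>M\<close>, except for one possible orbit.\<close>

lemma card_immortal_le:
  assumes y: "\<And>i. i < m \<Longrightarrow> y i \<le> M \<and> fst (label (y i)) = 2"
    and distinct: "\<And>i j. i < m \<Longrightarrow> j < m \<Longrightarrow> conn S (y i) (y j) \<Longrightarrow> i = j"
  shows "m \<le> Suc (card {w. w \<le> M \<and> immortal w})"
proof -
  let ?T = "{w. w \<le> M \<and> immortal w}"
  have "inj_on (\<lambda>i. snd (label (y i))) {..<m}"
  proof (rule inj_onI)
    fix i j assume ij: "i \<in> {..<m}" "j \<in> {..<m}" "snd (label (y i)) = snd (label (y j))"
    then have "fst (label (y i)) = 2" "fst (label (y j)) = 2" using y by auto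
    then have "label (y i) = label (y j)" using ij(3) by (simp add: prod_eq_iff)
    then show "i = j" using label_eq_conn distinct ij y by blast
  qed
  moreover have "(\<lambda>i. snd (label (y i))) ` {..<m} \<subseteq> insert (next_immortal M) ?T"
  proof
    fix l assume "l \<in> (\<lambda>i. snd (label (y i))) ` {..<m}"
    then obtain i where i: "i < m" "l = snd (label (y i))" by blast
    then obtain r where r: "r \<le> M" "l = next_immortal r"
      using label_row_le[of "y i"] y[OF i(1)] by (metis le_trans snd_conv)
    \<comment> \<open>All rows \<open>r <= M\<close> whose next immortal row exceeds
      \<open>M\<close> share that row, because no row from \<open>r\<close> to \<open>M\<close> is
      then immortal. This is the exceptional orbit.\<close>
    have "l = next_immortal M" if "\<not> l \<le> M"
    proof (rule le_antisym)
      show "next_immortal M \<le> l" using that next_immortal(2) r by (intro next_immortal_le) auto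
      show "l \<le> next_immortal M"
        using next_immortal[of M] r by (auto intro!: next_immortal_le intro: le_trans)
    qed
    then show "l \<in> insert (next_immortal M) ?T" using next_immortal(2) r(2) by auto
  qed
  ultimately have "card {..<m} \<le> card (insert (next_immortal M) ?T)"
    by (intro card_inj_on_le) auto
  also have "\<dots> \<le> Suc (card ?T)" by (rule card_insert_le_m1) auto
  finally show ?thesis by simp
qed

end

section \<open>Coding a limit approximation into row structures\<close>

text \<open>Row \<open>Suc s\<close> is immortal iff \<open>s\<close> is a true stage, one with
  \<open>a s < a r\<close> for all \<open>r > s\<close>. The shift keeps row 0 live for the inserted
  numbers.\<close>

definition stage_live :: "(nat \<Rightarrow> nat) \<Rightarrow> nat \<Rightarrow> nat \<Rightarrow> bool" where
  "stage_live a u t \<longleftrightarrow> u = 0 \<or> (\<forall>r\<le>t. u - 1 < r \<longrightarrow> a (u - 1) < a r)"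

text \<open>Take the least value of \<open>a\<close> from \<open>n\<close> on and the last stage at
  which it occurs; a last one exists because fibres are finite.\<close>

lemma ex_true_stage:
  fixes a :: "nat \<Rightarrow> nat"
  assumes fin: "\<And>n. finite {s. a s = n}"
  shows "\<exists>s\<ge>n. \<forall>r>s. a s < a r"
proof -
  define m where "m = (LEAST m. \<exists>s\<ge>n. a s = m)"
  have ex: "\<exists>s\<ge>n. a s = m" unfolding m_def by (rule LeastI[of _ "a n"], rule exI[of _ n]) simp
  have min: "m \<le> a r" if "r \<ge> n" for r unfolding m_def by (rule Least_le) (use that in blast)
  let ?T = "{s. n \<le> s \<and> a s = m}"
  have T: "finite ?T" "?T \<noteq> {}" using finite_subset[OF _ fin[of m], of ?T] ex by auto
  then have "Max ?T \<in> ?T" by (rule Max_in)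
  moreover have "m < a r" if "r > Max ?T" for r
  proof -
    have "r \<ge> n" using that \<open>Max ?T \<in> ?T\<close> by simp
    moreover have "a r \<noteq> m" using Max_ge[OF T(1), of r] that \<open>r \<ge> n\<close> by auto
    ultimately show ?thesis using min[of r] by simp
  qed
  ultimately show ?thesis by (intro exI[of _ "Max ?T"]) auto
qed

lemma row_structure_always: "inj A \<Longrightarrow> row_structure A (\<lambda>_ _. True)"
  by unfold_locales auto

lemma row_structure_stage_live:
  assumes "inj A" and fin: "\<And>n. finite {s. a s = n}"
  shows "row_structure A (stage_live a)"
proof
  show "\<exists>u\<ge>n. \<forall>t. stage_live a u t" for n
  proof -
    obtain s where "s \<ge> n" "\<forall>r>s. a s < a r" using ex_true_stage[OF fin] by blast
    then show ?thesis unfolding stage_live_def by (intro exI[of _ "Suc s"]) auto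
  qed
qed (use assms in \<open>auto simp: stage_live_def\<close>)

text \<open>An isomorphism sends the first rows to different immortal rows, so it grows faster than the
  true stages of \<open>a\<close>.\<close>

lemma isomorphism_bounds_stages:
  assumes A: "inj A" and fin: "\<And>n. finite {s. a s = n}"
    and h: "isomorphism (row_structure.S A (\<lambda>_ _. True) two I) (row_structure.S A (stage_live a) two I) h"
    and M: "\<And>i. i < n + 3 \<Longrightarrow> h (code 2 i 0) \<le> M"
    and s: "a s \<le> n"
  shows "s \<le> M"
proof (rule ccontr)
  assume sM: "\<not> s \<le> M"
  interpret R1: row_structure A "\<lambda>_ _. True" two I by (rule row_structure_always[OF A])
  interpret R2: row_structure A "stage_live a" two I by (rule row_structure_stage_live[OF A fin])
  have two: "R1.twosided_rows = two" "R2.twosided_rows = two"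
    unfolding R1.twosided_rows_def R2.twosided_rows_def by auto
  have imm: "R1.immortal u" for u unfolding R1.immortal_def by simp
  \<comment> \<open>At most \<open>n\<close> immortal rows up to \<open>M\<close> come from true
    stages, row 0 is one more, and one orbit may have its immortal row beyond \<open>M\<close>. So
    \<open>n + 3\<close> orbits are one too many.\<close>
  have "n + 3 \<le> Suc (card {w. w \<le> M \<and> R2.immortal w})"
  proof (rule R2.card_immortal_le[where y = "\<lambda>i. h (code 2 i 0)"])
    fix i assume i: "i < n + 3"
    have "code 2 i 0 \<in> (if two then twosided R1.S else roots R1.S)"
      using R1.row_depth[of i] imm unfolding R1.starts_def two by simp
    then have "h (code 2 i 0) \<in> (if two then twosided R2.S else roots R2.S)"
      using isomorphism_range[OF h] isomorphism_range[OF h, where k = 1] isomorphism_periodic[OF h]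
      unfolding twosided_def roots_def by (simp split: if_splits)
    then show "h (code 2 i 0) \<le> M \<and> fst (R2.label (h (code 2 i 0))) = 2"
      using R2.label_row_type M[OF i] unfolding two by blast
  next
    fix i j assume "conn R2.S (h (code 2 i 0)) (h (code 2 j 0))"
    then have "R1.label (code 2 i 0) = R1.label (code 2 j 0)"
      using isomorphism_conn[OF h] R1.label_conn by blast
    then show "i = j" using R1.next_immortal_immortal[OF imm] by simp
  qed
  moreover have "{w. w \<le> M \<and> R2.immortal w} \<subseteq> insert 0 (Suc ` {r. r < M \<and> R2.immortal (Suc r)})"
    by (auto simp: image_iff) (metis Suc_le_eq not0_implies_Suc)
  then have "card {w. w \<le> M \<and> R2.immortal w} \<le> card (insert 0 (Suc ` {r. r < M \<and> R2.immortal (Suc r)}))"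
    by (intro card_mono) auto
  moreover have "\<dots> \<le> Suc (card {r. r < M \<and> R2.immortal (Suc r)})"
    by (simp add: card_insert_if card_image)
  moreover have "card {r. r < M \<and> R2.immortal (Suc r)} \<le> card {..<n}"
  proof (rule card_inj_on_le)
    \<comment> \<open>\<open>a\<close> is strictly increasing along true stages, and those below
      \<open>M\<close> precede the stage \<open>s > M\<close> with \<open>a s <= n\<close>. So their
      values are distinct numbers below \<open>n\<close>.\<close>
    have mono: "a r < a q" if "R2.immortal (Suc r)" "r < q" for r q
      using that unfolding R2.immortal_def stage_live_def by auto
    show "inj_on a {r. r < M \<and> R2.immortal (Suc r)}"
      by (rule inj_onI) (metis (lifting) linorder_neqE_nat mem_Collect_eq mono less_irrefl)
    show "a ` {r. r < M \<and> R2.immortal (Suc r)} \<subseteq> {..<n}"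
      using mono[of _ s] sM s by fastforce
  qed simp
  ultimately show False by simp
qed

lemma le_rec_sum: "i < m \<Longrightarrow> F i \<le> rec_nat 0 (\<lambda>i y. y + F i) (m :: nat)" for F :: "nat \<Rightarrow> nat"
  by (induction m) (auto simp: less_Suc_eq intro: trans_le_add1)

lemma Delta_fun_2_pr_le:
  assumes A: "primitive_recursive A" "inj A" and inf: "infinite (roots A \<union> twosided_reps A)"
    and cat: "\<And>B. punctual B \<Longrightarrow> isomorphic_1 B A \<Longrightarrow>
      \<exists>h. isomorphism A B h \<and> h \<le>PR g \<and> inv h \<le>PR g"
    and f: "Delta_fun 2 f"
  shows "f \<le>PR g"
proof -
  from Delta_fun_2_limit[OF f] obtain a guess where a: "pr_definable 1 (\<lambda>xs. a (hd xs))"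
    and guess: "pr_definable 2 (\<lambda>xs. guess (hd xs) (hd (tl xs)))"
    and fin: "\<And>n. finite {s. a s = n}"
    and lim: "\<And>n M. (\<And>s. a s \<le> n \<Longrightarrow> s \<le> M) \<Longrightarrow> f n = guess n M" by blast
  \<comment> \<open>If there are only finitely many two-sided chains, there are infinitely many
    roots, and the rows become omega-chains.\<close>
  define two where "two = infinite (twosided_reps A)"
  define VE where "VE = (if two then roots A else twosided_reps A)"
  \<comment> \<open>\<open>I\<close> is omega or a finite initial segment. Which one is fixed by
    \<open>A\<close>, and membership is primitive recursive in both cases.\<close>
  define I where "I = {i. infinite VE \<or> i < card VE}"
  have "\<exists>k. bij_betw k VE I"
  proof (cases "finite VE")
    case True
    then show ?thesis using ex_bij_betw_finite_nat[OF True] unfolding I_def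
      by (simp add: atLeast0LessThan lessThan_def)
  next
    case False
    then show ?thesis using bij_betw_inv_into[OF bij_enumerate[OF False]] unfolding I_def by auto
  qed
  then obtain k where k: "bij_betw k VE I" by blast
  have I: "pr_decidable 1 (\<lambda>xs. hd xs \<in> I)"
    unfolding I_def mem_Collect_eq by (intro pr.definable_intros; simp)
  have VR: "infinite (if two then twosided_reps A else roots A)"
    using inf unfolding two_def by auto
  interpret R1: row_structure A "\<lambda>_ _. True" two I by (rule row_structure_always[OF A(2)])
  interpret R2: row_structure A "stage_live a" two I by (rule row_structure_stage_live[OF A(2) fin])
  have two: "R1.twosided_rows = two" "R2.twosided_rows = two"
    unfolding R1.twosided_rows_def R2.twosided_rows_def by auto
  have iso: "isomorphic_1 R1.S A" "isomorphic_1 R2.S A"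
    using R1.isomorphic[unfolded two, OF VR] R2.isomorphic[unfolded two, OF VR] k isomorphism_inv
    unfolding isomorphic_1_def VE_def by blast+
  have "pr_decidable 2 (\<lambda>xs. True)" by (intro pr.definable_intros)
  then have "punctual R1.S" unfolding punctual_def by (intro R1.primitive_recursive_S A I)
  then obtain h1 where h1: "isomorphism A R1.S h1" "h1 \<le>PR g" "inv h1 \<le>PR g"
    using cat iso by blast
  have "pr_decidable 2 (\<lambda>xs. stage_live a (hd xs) (hd (tl xs)))"
    unfolding stage_live_def by (intro pr.definable_intros pr.definable_app1[OF a]; simp)
  then have "punctual R2.S" unfolding punctual_def by (intro R2.primitive_recursive_S A I)
  then obtain h2 where h2: "isomorphism A R2.S h2" "h2 \<le>PR g" "inv h2 \<le>PR g"
    using cat iso by blast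
  \<comment> \<open>The spectrum gives isomorphisms from \<open>A\<close> only, so the map between
    the two copies passes through \<open>A\<close>. This is where the reducibility of an inverse
    enters.\<close>
  define h where "h = h2 \<circ> inv h1"
  have h: "isomorphism R1.S R2.S h" unfolding h_def
    by (rule isomorphism_comp[OF isomorphism_inv[OF h1(1)] h2(1)])
  have h_le: "opr_definable g 1 (\<lambda>xs. h (hd xs))"
    using pr_le_comp[OF h2(2) h1(3)] unfolding h_def pr_le_iff .
  \<comment> \<open>The sum is an upper bound, primitive recursive in \<open>h\<close>, for the
    values of \<open>h\<close> at column 0 of the first \<open>n + 3\<close> rows.\<close>
  define M where "M n = rec_nat 0 (\<lambda>i y. y + h (code 2 i 0)) (n + 3)" for n
  have "f n = guess n (M n)" for n
    by (rule lim, rule isomorphism_bounds_stages[OF A(2) fin h]) (auto simp: M_def intro: le_rec_sum)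
  moreover have "opr_definable g 1 (\<lambda>xs. guess (hd xs) (M (hd xs)))"
    unfolding M_def code_def
    by (intro opr.definable_intros opr.definable_app2[OF opr.definable_pr[OF guess]]
        opr.definable_rec opr.definable_app1[OF h_le]; simp)
  ultimately show ?thesis unfolding pr_le_iff by simp
qed

theorem theorem2p3:
  fixes A :: structure_1
  assumes "punctual A"
    and "injection_structure A"
    and "relatively_Delta_categorical 2 A"
    and "\<not> relatively_Delta_categorical 1 A"
  shows "PRCatSpec A = Cone_Delta 2"
proof -
  have A: "primitive_recursive A" "inj A"
    using assms unfolding punctual_def injection_structure_def by auto
  then have inf: "infinite (roots A \<union> twosided_reps A)"
    using relatively_Delta_1_categorical assms(4) by blast
  have "d \<in> Cone_Delta 2" if d: "d \<in> PRCatSpec A" for d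
  proof -
    \<comment> \<open>Reductions to a degree are reductions to any one of its
      representatives.\<close>
    obtain g where g: "\<And>f. pr_le_degree f d \<longleftrightarrow> f \<le>PR g"
      using d pr_degrees_cases unfolding PRCatSpec_def by blast
    then show ?thesis using d Delta_fun_2_pr_le[OF A inf, of g]
      unfolding PRCatSpec_def Cone_Delta_def by blast
  qed
  moreover have "d \<in> PRCatSpec A" if d: "d \<in> Cone_Delta 2" for d
  proof -
    have "\<exists>h. isomorphism A B h \<and> pr_le_degree h d \<and> pr_le_degree (inv h) d"
      if B: "punctual B" "isomorphic_1 B A" for B
    proof -
      obtain h where h: "isomorphism A B h" "Delta_fun_in 2 (char_fun (atomic_diagram B)) h"
        using assms(3) B(2) unfolding relatively_Delta_categorical_def by blast
      have "rec_definable (\<lambda>_. 0) 1 (\<lambda>xs. B (hd xs))"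
        using B(1) rec.definable_pr unfolding punctual_def primitive_recursive_iff by blast
      then have "Delta_fun 2 h" unfolding Delta_fun_def
        using Delta_fun_in_trans[OF h(2)] rec.decidable_atomic_diagram by blast
      moreover from this have "Delta_fun 2 (inv h)"
        using Delta_fun_inv h(1) unfolding isomorphism_def by blast
      ultimately show ?thesis using h(1) d unfolding Cone_Delta_def by blast
    qed
    then show ?thesis using d unfolding PRCatSpec_def Cone_Delta_def by blast
  qed
  ultimately show ?thesis by blast
qed

end
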